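(* Let $K$ be any field and let $\mathbf Q=\mathrm{Lie}(v_0,v_1,v_2)$. Then with respect to the generating set $\{v_0,v_1,v_2\}$, $$\mathrm{GKdim}\,\mathbf Q=\underline{\mathrm{GKdim}}\,\mathbf Q=\log_\lambda 2\approx1.6518,$$ where $\lambda\approx1.5214$ is the real root of $t^3-t-2$.
   Context: $\Lambda$ is the Grassmann algebra over $K$ on odd generators $x_0,x_1,\dots$; $x_i$ acts by left multiplication; $\partial_i$ is the odd superderivation with $\partial_i(x_j)=\delta_{ij}$; pivot elements $v_i=\sum_{k\ge0}\big(\prod_{n=0}^{k-1}x_{i+3n}x_{i+3n+1}\big)\partial_{i+3k}$. $\mathbf Q$ is the Lie subsuperalgebra of $(\operatorname{End}\Lambda)^{(-)}$ generated by $v_0,v_1,v_2$ (closed also under squaring of odd elements if $\operatorname{char}K=2$). The growth function $\gamma(n)$ is the dimension of the span of all Lie monomials (commutators) in $v_0,v_1,v_2$ of length at most $n$ (in characteristic $2$ also squares of odd such monomials of length at most $n/2$); $\mathrm{GKdim}=\limsup_{n\to\infty}\ln\gamma(n)/\ln n$ and $\underline{\mathrm{GKdim}}=\liminf_{n\to\infty}\ln\gamma(n)/\ln n$. *)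

theory Defs
  imports Complex_Main "HOL-Library.Function_Algebras" "HOL-Library.Liminf_Limsup" "HOL-Library.Extended_Real"
begin

text \<open>The Grassmann algebra Lambda over a field 'k on odd generators x_0, x_1, ...
  has the basis of monomials x_S = x_{s_1} x_{s_2} ... x_{s_k} (s_1 < ... < s_k)
  indexed by finite sets S of naturals.  A linear operator A on Lambda is represented
  by its matrix: A S T is the coefficient of x_T in A(x_S).  Operators vanish on
  (meaningless) infinite index sets S.\<close>

type_synonym 'k op = "nat set \<Rightarrow> nat set \<Rightarrow> 'k"

definition sgn_before :: "nat \<Rightarrow> nat set \<Rightarrow> 'k::field" where
  "sgn_before i S = (-1) ^ card {j \<in> S. j < i}"

definition lmul :: "nat \<Rightarrow> 'k::field op" where
  "lmul i S T = (if finite S \<and> i \<notin> S \<and> T = insert i S then sgn_before i S else 0)"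

text \<open>the odd superderivation d_i with d_i(x_j) = delta_ij\<close>
definition pder :: "nat \<Rightarrow> 'k::field op" where
  "pder i S T = (if finite S \<and> i \<in> S \<and> T = S - {i} then sgn_before i S else 0)"

definition ocomp :: "'k::field op \<Rightarrow> 'k op \<Rightarrow> 'k op" where
  "ocomp A B S U = (\<Sum>T | B S T \<noteq> 0. B S T * A T U)"

definition oid :: "'k::field op" where
  "oid S T = (if finite S \<and> T = S then 1 else 0)"

definition pivot_idx :: "nat \<Rightarrow> nat \<Rightarrow> nat list" where
  "pivot_idx i k = concat (map (\<lambda>n. [i + 3*n, i + 3*n + 1]) [0..<k])"

definition pivot_term :: "nat \<Rightarrow> nat \<Rightarrow> 'k::field op" where
  "pivot_term i k = ocomp (foldr (\<lambda>j A. ocomp (lmul j) A) (pivot_idx i k) oid) (pder (i + 3*k))"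

text \<open>pivot element v_i; on x_S only the summands with i+3k in S are nonzero\<close>
definition pivot :: "nat \<Rightarrow> 'k::field op" where
  "pivot i S U = (\<Sum>k | i + 3*k \<in> S. pivot_term i k S U)"

definition sbracket :: "nat \<Rightarrow> nat \<Rightarrow> 'k::field op \<Rightarrow> 'k op \<Rightarrow> 'k op" where
  "sbracket p q A B S T = ocomp A B S T - (-1) ^ (p * q) * ocomp B A S T"

inductive_set lie_mono :: "(nat \<times> 'k::field op) set" where
  gen: "i < 3 \<Longrightarrow> (1, pivot i) \<in> lie_mono"
| br: "(m, a) \<in> lie_mono \<Longrightarrow> (n, b) \<in> lie_mono \<Longrightarrow> (m + n, sbracket m n a b) \<in> lie_mono"

definition growth_set :: "'k::field itself \<Rightarrow> nat \<Rightarrow> 'k op set" where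
  "growth_set _ n = {a. \<exists>m \<le> n. (m, a) \<in> lie_mono}
     \<union> (if CHAR('k) = 2 then {ocomp a a | a m. (m, a) \<in> lie_mono \<and> odd m \<and> 2 * m \<le> n} else {})"

definition oscale :: "'k::field \<Rightarrow> 'k op \<Rightarrow> 'k op" where
  "oscale c A = (\<lambda>S T. c * A S T)"

definition lie_growth :: "'k::field itself \<Rightarrow> nat \<Rightarrow> nat" where
  "lie_growth K n = vector_space.dim (oscale :: 'k \<Rightarrow> 'k op \<Rightarrow> 'k op) (growth_set K n)"

definition pivot_lambda :: real where
  "pivot_lambda = (THE t::real. t ^ 3 - t - 2 = 0)"

end

theory Submission
  imports Defs
begin

text \<open>Give \<open>v_i\<close> the weight \<open>a_i\<close> with \<open>a_0 = a_1 = a_2 = 1\<close> and \<open>a_{i+3} = 2 a_i + a_{i+1}\<close>, and \<open>x_i\<close> the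
  weight \<open>- a_i\<close>. From \<open>v_i = d_i + x_i x_{i+1} v_{i+3}\<close> one gets \<open>v_i^2 = x_{i+1} v_{i+3}\<close>,
  \<open>[v_i, v_{i+1}] = - x_i v_{i+3}\<close> and \<open>[v_i, v_m] = x_i x_{i+1} [v_{i+3}, v_m]\<close> for \<open>m > i + 1\<close>.

  Upper bound: the integral combinations of \<open>r v_N\<close>, where \<open>r\<close> is a monomial in \<open>x_0, ..., x_{N-3}\<close>, or
  \<open>x_{N-2}\<close> times a monomial in \<open>x_0, ..., x_{N-5}\<close>, are closed under superbrackets and under squares
  of odd elements, and the length of a Lie monomial is its weight. Such an \<open>r v_N\<close> has weight at
  least \<open>a_N / 11\<close>, so lengths up to \<open>n\<close> only involve \<open>N\<close> up to \<open>log_\<lambda> n + O(1)\<close>, which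
  leaves \<open>O(2^N)\<close> monomials.

  Lower bound: if \<open>r\<close> is a monomial without \<open>x_j\<close> and \<open>j < n\<close>, then \<open>[v_j, x_j r v_n] = r v_n\<close>, so letters
  can be deleted at will. The monomial \<open>x_0 ... x_{n-3} v_n\<close> is, up to sign, a commutator for every
  positive multiple \<open>n\<close> of \<open>5\<close>, because bracketing it with \<open>x_{n-2} x_{n-1} v_{n+2}\<close> yields
  \<open>x_0 ... x_{n+2} v_{n+5}\<close>. Hence all \<open>2^{n-2}\<close> elements \<open>r v_n\<close> with \<open>r\<close> in \<open>x_0, ..., x_{n-3}\<close> are
  commutators of length at most \<open>a_n\<close>.\<close>

section \<open>The ring of row-finite operators\<close>

text \<open>These are the matrices of actual endomorphisms of Lambda: each A(x_S) is a finite
  combination of basis monomials. On them the sum in \<open>ocomp\<close> is finite; an infinite sum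
  would be \<open>0\<close> by convention.\<close>

definition row_finite :: "'k::field op \<Rightarrow> bool" where
  "row_finite A \<longleftrightarrow> (\<forall>S. finite {T. A S T \<noteq> 0}) \<and> (\<forall>S T. A S T \<noteq> 0 \<longrightarrow> finite S \<and> finite T)"

lemma ocomp_eq_sum:
  assumes "finite F" "{T. B S T \<noteq> 0} \<subseteq> F"
  shows "ocomp A B S U = (\<Sum>T\<in>F. B S T * A T U)"
  unfolding ocomp_def by (rule sum.mono_neutral_left) (use assms in auto)

lemma ocomp_nonzero:
  assumes "ocomp A B S U \<noteq> 0"
  obtains T where "B S T \<noteq> 0" "A T U \<noteq> 0"
proof (rule ccontr)
  assume "\<not> thesis"
  with that have "B S T * A T U = 0" for T by auto
  with assms show False by (simp add: ocomp_def)
qed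

lemma row_finiteI:
  "(\<And>S. finite {T. A S T \<noteq> 0}) \<Longrightarrow> (\<And>S T. A S T \<noteq> 0 \<Longrightarrow> finite S) \<Longrightarrow>
    (\<And>S T. A S T \<noteq> 0 \<Longrightarrow> finite T) \<Longrightarrow> row_finite A"
  unfolding row_finite_def by blast

lemma row_finite_ocomp:
  assumes "row_finite A" "row_finite B"
  shows "row_finite (ocomp A B)"
proof (rule row_finiteI)
  fix S
  have "{U. ocomp A B S U \<noteq> 0} \<subseteq> (\<Union>T\<in>{T. B S T \<noteq> 0}. {U. A T U \<noteq> 0})"
    by (auto elim!: ocomp_nonzero)
  moreover have "finite (\<Union>T\<in>{T. B S T \<noteq> 0}. {U. A T U \<noteq> 0})"
    using assms by (intro finite_UN_I) (auto simp: row_finite_def)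
  ultimately show "finite {U. ocomp A B S U \<noteq> 0}"
    by (rule finite_subset)
next
  fix S U assume "ocomp A B S U \<noteq> 0"
  then obtain T where "B S T \<noteq> 0" "A T U \<noteq> 0" by (rule ocomp_nonzero)
  with assms show "finite S" "finite U" by (auto simp: row_finite_def)
qed

lemma row_finite_zero: "row_finite (\<lambda>S T. 0)"
  by (simp add: row_finite_def)

lemma row_finite_add:
  assumes "row_finite A" "row_finite B"
  shows "row_finite (\<lambda>S T. A S T + B S T)"
proof (rule row_finiteI)
  fix S
  have "{T. A S T + B S T \<noteq> 0} \<subseteq> {T. A S T \<noteq> 0} \<union> {T. B S T \<noteq> 0}" by auto
  moreover have "finite ({T. A S T \<noteq> 0} \<union> {T. B S T \<noteq> 0})"
    using assms by (simp add: row_finite_def)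
  ultimately show "finite {T. A S T + B S T \<noteq> 0}" by (rule finite_subset)
next
  fix S T assume "A S T + B S T \<noteq> 0"
  then have "A S T \<noteq> 0 \<or> B S T \<noteq> 0" by auto
  with assms show "finite S" "finite T" unfolding row_finite_def by blast+
qed

lemma row_finite_uminus: "row_finite A \<Longrightarrow> row_finite (\<lambda>S T. - A S T)"
  by (simp add: row_finite_def)

lemma row_finite_oid: "row_finite oid"
  by (auto simp: row_finite_def oid_def)

lemma row_finite_lmul: "row_finite (lmul i)"
  by (auto simp: row_finite_def lmul_def)

lemma row_finite_pder: "row_finite (pder i)"
  by (auto simp: row_finite_def pder_def)

text \<open>Both iterated sums are taken over the finite sets \<open>?F\<close> and
  \<open>?G\<close>, where \<open>?G\<close> collects every index reachable from S through C and
  then B, so their order can be exchanged.\<close>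

lemma ocomp_assoc:
  assumes "row_finite A" "row_finite B" "row_finite C"
  shows "ocomp (ocomp A B) C = ocomp A (ocomp B C)"
proof (intro ext)
  fix S U
  let ?F = "{T. C S T \<noteq> 0}"
  let ?G = "\<Union>T\<in>?F. {T'. B T T' \<noteq> 0}"
  have F: "finite ?F" and G: "finite ?G"
    using assms by (auto simp: row_finite_def)
  have "ocomp (ocomp A B) C S U = (\<Sum>T\<in>?F. C S T * (\<Sum>T'\<in>?G. B T T' * A T' U))"
    unfolding ocomp_eq_sum[where B = C, OF F subset_refl]
    by (intro sum.cong arg_cong2[where f = "(*)"] ocomp_eq_sum refl G) auto
  also have "\<dots> = (\<Sum>T'\<in>?G. (\<Sum>T\<in>?F. C S T * B T T') * A T' U)"
    unfolding sum_distrib_left sum_distrib_right by (subst sum.swap) (simp add: mult.assoc)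
  also have "\<dots> = (\<Sum>T'\<in>?G. ocomp B C S T' * A T' U)"
    by (simp add: ocomp_def)
  also have "\<dots> = ocomp A (ocomp B C) S U"
    by (rule ocomp_eq_sum[symmetric, OF G]) (auto elim!: ocomp_nonzero)
  finally show "ocomp (ocomp A B) C S U = ocomp A (ocomp B C) S U" .
qed

lemma ocomp_add_left:
  "ocomp (\<lambda>S T. A S T + B S T) C = (\<lambda>S T. ocomp A C S T + ocomp B C S T)"
  by (simp add: ocomp_def fun_eq_iff sum.distrib distrib_left)

lemma ocomp_add_right:
  assumes "row_finite A" "row_finite B"
  shows "ocomp C (\<lambda>S T. A S T + B S T) = (\<lambda>S T. ocomp C A S T + ocomp C B S T)"
proof (intro ext)
  fix S U
  let ?F = "{T. A S T \<noteq> 0} \<union> {T. B S T \<noteq> 0}"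
  have F: "finite ?F" using assms by (simp add: row_finite_def)
  have "ocomp C (\<lambda>S T. A S T + B S T) S U = (\<Sum>T\<in>?F. (A S T + B S T) * C T U)"
    by (rule ocomp_eq_sum[OF F]) auto
  also have "\<dots> = (\<Sum>T\<in>?F. A S T * C T U) + (\<Sum>T\<in>?F. B S T * C T U)"
    by (simp add: distrib_right sum.distrib)
  also have "\<dots> = ocomp C A S U + ocomp C B S U"
    by (intro arg_cong2[where f = "(+)"] ocomp_eq_sum[symmetric] F) auto
  finally show "ocomp C (\<lambda>S T. A S T + B S T) S U = ocomp C A S U + ocomp C B S U" .
qed

lemma ocomp_oid_left:
  assumes "row_finite A" shows "ocomp oid A = A"
proof (intro ext)
  fix S U
  have F: "finite (insert U {T. A S T \<noteq> 0})" using assms by (simp add: row_finite_def)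
  have "ocomp oid A S U = (\<Sum>T\<in>insert U {T. A S T \<noteq> 0}. A S T * oid T U)"
    by (rule ocomp_eq_sum[OF F]) auto
  also have "\<dots> = (\<Sum>T\<in>insert U {T. A S T \<noteq> 0}. if T = U then A S U else 0)"
    using assms by (intro sum.cong) (auto simp: oid_def row_finite_def)
  also have "\<dots> = A S U" using F by simp
  finally show "ocomp oid A S U = A S U" .
qed

lemma ocomp_oid_right:
  assumes "row_finite A" shows "ocomp A oid = A"
proof (intro ext)
  fix S U
  have "ocomp A oid S U = (\<Sum>T\<in>{S}. oid S T * A T U)"
    by (rule ocomp_eq_sum) (auto simp: oid_def)
  also have "\<dots> = A S U" using assms by (auto simp: oid_def row_finite_def)
  finally show "ocomp A oid S U = A S U" .
qed

text \<open>Packing row finiteness into a type makes the operators a \<open>ring_1\<close>, so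
  products can be simplified without side conditions.\<close>

typedef (overloaded) 'k rop = "{A :: 'k::field op. row_finite A}"
  morphisms mat Rop
  by (rule exI[of _ "\<lambda>S T. 0"]) (simp add: row_finite_zero)

setup_lifting type_definition_rop

instantiation rop :: (field) ring_1
begin

lift_definition zero_rop :: "'a rop" is "\<lambda>S T. 0" by (rule row_finite_zero)
lift_definition one_rop :: "'a rop" is oid by (rule row_finite_oid)
lift_definition plus_rop :: "'a rop \<Rightarrow> 'a rop \<Rightarrow> 'a rop" is "\<lambda>A B S T. A S T + B S T"
  by (rule row_finite_add)
lift_definition uminus_rop :: "'a rop \<Rightarrow> 'a rop" is "\<lambda>A S T. - A S T"
  by (rule row_finite_uminus)
lift_definition minus_rop :: "'a rop \<Rightarrow> 'a rop \<Rightarrow> 'a rop" is "\<lambda>A B S T. A S T + - B S T"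
  by (intro row_finite_add row_finite_uminus)
lift_definition times_rop :: "'a rop \<Rightarrow> 'a rop \<Rightarrow> 'a rop" is ocomp
  by (rule row_finite_ocomp)

instance
proof
  fix a b c :: "'a rop"
  show "a * b * c = a * (b * c)" by transfer (rule ocomp_assoc)
  show "(a + b) * c = a * c + b * c" by transfer (rule ocomp_add_left)
  show "a * (b + c) = a * b + a * c" by transfer (rule ocomp_add_right)
  show "1 * a = a" by transfer (rule ocomp_oid_left)
  show "a * 1 = a" by transfer (rule ocomp_oid_right)
  show "a + b + c = a + (b + c)" by transfer (simp add: add.assoc)
  show "a + b = b + a" by transfer (simp add: add.commute)
  show "0 + a = a" by transfer simp
  show "- a + a = 0" by transfer simp
  show "a - b = a + - b" by transfer simp
  show "(0::'a rop) \<noteq> 1"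
    by transfer (auto simp: oid_def fun_eq_iff intro: exI[of _ "{}"])
qed

end

text \<open>The right factor acts first, so x_S enters the product only through B(x_S). An infinite
  sum can thus be replaced by a finite one, row by row.\<close>

lemma mat_times_cong: "mat B S = mat B' S \<Longrightarrow> mat (A * B) S = mat (A * B') S"
  by transfer (simp add: ocomp_def fun_eq_iff)

lemma mat_times_zero: "mat B S = (\<lambda>T. 0) \<Longrightarrow> mat (A * B) S = (\<lambda>T. 0)"
  by transfer (simp add: ocomp_def fun_eq_iff)

lemma mat_add: "mat (A + B) S T = mat A S T + mat B S T"
  by transfer simp

lemma mat_uminus: "mat (- A) S T = - mat A S T"
  by transfer simp

lemma mat_minus: "mat (A - B) S T = mat A S T - mat B S T"
  by transfer simp

lemma mat_zero: "mat 0 S T = 0"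
  by transfer simp

lemma mat_sum: "mat (\<Sum>i\<in>I. f i) S T = (\<Sum>i\<in>I. mat (f i) S T)"
  by (induction I rule: infinite_finite_induct) (simp_all add: mat_zero mat_add)

section \<open>Clifford relations and the pivot elements\<close>

lift_definition Xop :: "nat \<Rightarrow> 'k::field rop" is lmul by (rule row_finite_lmul)
lift_definition Dop :: "nat \<Rightarrow> 'k::field rop" is pder by (rule row_finite_pder)

lemma sgn_before_insert:
  "finite S \<Longrightarrow> i \<notin> S \<Longrightarrow>
    (sgn_before j (insert i S) :: 'k::field) = (if i < j then - sgn_before j S else sgn_before j S)"
proof -
  assume "finite S" "i \<notin> S"
  moreover have "{k \<in> insert i S. k < j} = (if i < j then insert i {k \<in> S. k < j} else {k \<in> S. k < j})"
    by auto
  ultimately show ?thesis by (simp add: sgn_before_def)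
qed

lemma sgn_before_remove:
  assumes "finite S" "i \<in> S"
  shows "(sgn_before j (S - {i}) :: 'k::field) = (if i < j then - sgn_before j S else sgn_before j S)"
  using sgn_before_insert[of "S - {i}" i j, where 'k = 'k] assms by (auto simp: insert_absorb)

lemma sgn_before_square [simp]: "sgn_before i S * sgn_before i S = 1"
  by (simp add: sgn_before_def flip: power_add)

lemma ocomp_lmul:
  "ocomp A (lmul i) S U = (if finite S \<and> i \<notin> S then sgn_before i S * A (insert i S) U else 0)"
proof -
  have "ocomp A (lmul i) S U = (\<Sum>T\<in>{insert i S}. lmul i S T * A T U)"
    by (rule ocomp_eq_sum) (auto simp: lmul_def)
  then show ?thesis by (simp add: lmul_def)
qed

lemma ocomp_pder:
  "ocomp A (pder i) S U = (if finite S \<and> i \<in> S then sgn_before i S * A (S - {i}) U else 0)"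
proof -
  have "ocomp A (pder i) S U = (\<Sum>T\<in>{S - {i}}. pder i S T * A T U)"
    by (rule ocomp_eq_sum) (auto simp: pder_def)
  then show ?thesis by (simp add: pder_def)
qed

lemma lmul_lmul: "ocomp (lmul i) (lmul j) = (\<lambda>S U. - ocomp (lmul j) (lmul i) S U)"
proof (intro ext)
  fix S U
  show "ocomp (lmul i) (lmul j) S U = - ocomp (lmul j) (lmul i) S U"
    by (rule linorder_cases[of i j])
      (simp_all add: ocomp_lmul lmul_def sgn_before_insert insert_commute[of j i])
qed

lemma pder_pder: "ocomp (pder i) (pder j) = (\<lambda>S U. - ocomp (pder j) (pder i) S U)"
proof (intro ext)
  fix S U :: "nat set"
  have "S - {i} - {j} = S - {j} - {i}" by blast
  then show "ocomp (pder i) (pder j) S U = - ocomp (pder j) (pder i) S U"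
    by (rule_tac linorder_cases[of i j]) (simp_all add: ocomp_pder pder_def sgn_before_remove)
qed

lemma pder_lmul:
  assumes "i \<noteq> j"
  shows "ocomp (pder i) (lmul j) = (\<lambda>S U. - ocomp (lmul j) (pder i) S U)"
proof (intro ext)
  fix S U
  show "ocomp (pder i) (lmul j) S U = - ocomp (lmul j) (pder i) S U"
  proof (cases "finite S \<and> i \<in> S \<and> j \<notin> S")
    case True
    moreover have "insert j S - {i} = insert j (S - {i})" using assms by auto
    ultimately show ?thesis using assms
      by (cases "i < j")
        (simp_all add: ocomp_pder ocomp_lmul pder_def lmul_def sgn_before_remove sgn_before_insert)
  next
    case False
    with assms show ?thesis by (auto simp: ocomp_pder ocomp_lmul pder_def lmul_def)
  qed
qed

lemma pder_lmul_same:
  "ocomp (pder i) (lmul i) = (\<lambda>S U. oid S U + - ocomp (lmul i) (pder i) S U)"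
proof (intro ext)
  fix S U
  show "ocomp (pder i) (lmul i) S U = oid S U + - ocomp (lmul i) (pder i) S U"
    by (cases "i \<in> S")
      (simp_all add: ocomp_pder ocomp_lmul pder_def lmul_def oid_def sgn_before_remove
        sgn_before_insert insert_absorb)
qed

lemma Xop_Xop: "Xop i * Xop j = - (Xop j * Xop i)"
  by transfer (rule lmul_lmul)

lemma Xop_sq: "Xop i * Xop i = 0"
  by transfer (simp add: fun_eq_iff ocomp_lmul lmul_def)

lemma Dop_Dop: "Dop i * Dop j = - (Dop j * Dop i)"
  by transfer (rule pder_pder)

lemma Dop_sq: "Dop i * Dop i = 0"
  by transfer (simp add: fun_eq_iff ocomp_pder pder_def)

lemma Dop_Xop: "i \<noteq> j \<Longrightarrow> Dop i * Xop j = - (Xop j * Dop i)"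
  by transfer (rule pder_lmul)

lemma Dop_Xop_same: "Dop i * Xop i = 1 - Xop i * Dop i"
  by transfer (rule pder_lmul_same)

definition Vop_term :: "nat \<Rightarrow> nat \<Rightarrow> 'k::field rop" where
  "Vop_term i k = prod_list (map Xop (pivot_idx i k)) * Dop (i + 3 * k)"

lemma mat_Vop_term: "mat (Vop_term i k :: 'k::field rop) = pivot_term i k"
proof -
  have "mat (prod_list (map Xop js) :: 'k rop) = foldr (\<lambda>j A. ocomp (lmul j) A) js oid" for js
    by (induction js) (simp_all add: one_rop.rep_eq times_rop.rep_eq Xop.rep_eq)
  then show ?thesis by (simp add: Vop_term_def pivot_term_def times_rop.rep_eq Dop.rep_eq)
qed

lemma Vop_term_0: "Vop_term i 0 = Dop i"
  by (simp add: Vop_term_def pivot_idx_def)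

lemma Vop_term_Suc: "Vop_term i (Suc k) = Xop i * Xop (Suc i) * Vop_term (i + 3) k"
proof -
  have "pivot_idx i (Suc k) = [i, i + 1] @ pivot_idx (i + 3) k"
    unfolding pivot_idx_def upt_conv_Cons[OF zero_less_Suc] map_Suc_upt[symmetric] by (simp add: comp_def add_ac)
  then show ?thesis by (simp add: Vop_term_def mult.assoc add_ac)
qed

lemma mat_Vop_term_zero: "i + 3 * k \<notin> S \<or> infinite S \<Longrightarrow> mat (Vop_term i k) S = (\<lambda>T. 0)"
  unfolding Vop_term_def by (rule mat_times_zero) (transfer, auto simp: pder_def fun_eq_iff)

text \<open>The summand with d_{i+3k} kills x_S unless i+3k lies in S, and then k <= i+3k <
  K.\<close>

lemma pivot_eq_sum:
  assumes "S \<subseteq> {..<K}"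
  shows "pivot i S = mat (\<Sum>k<K. Vop_term i k :: 'k::field rop) S"
proof
  fix U
  have "pivot i S U = (\<Sum>k | i + 3 * k \<in> S. mat (Vop_term i k :: 'k rop) S U)"
    by (simp add: pivot_def mat_Vop_term)
  also have "\<dots> = (\<Sum>k<K. mat (Vop_term i k) S U)"
    by (rule sum.mono_neutral_left) (use assms in \<open>auto simp: mat_Vop_term_zero\<close>)
  finally show "pivot i S U = mat (\<Sum>k<K. Vop_term i k :: 'k rop) S U" by (simp add: mat_sum)
qed

lemma pivot_infinite: "infinite S \<Longrightarrow> pivot i S U = 0"
  unfolding pivot_def mat_Vop_term[symmetric] by (simp add: mat_Vop_term_zero)

lemma row_finite_mat: "row_finite (mat A)"
  using mat[of A] by simp

lemma row_finite_pivot: "row_finite (pivot i :: 'k::field op)"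
proof -
  have "finite {T. pivot i S T \<noteq> (0::'k)} \<and> (\<forall>T. pivot i S T \<noteq> (0::'k) \<longrightarrow> finite T)" if "finite S" for S
  proof -
    from that obtain K where "S \<subseteq> {..<K}" using finite_nat_iff_bounded by auto
    from pivot_eq_sum[OF this, of i, where 'k = 'k] show ?thesis
      using row_finite_mat[of "\<Sum>k<K. Vop_term i k :: 'k rop"] by (auto simp: row_finite_def)
  qed
  then show ?thesis unfolding row_finite_def by (metis (mono_tags, lifting) Collect_empty_eq finite.emptyI pivot_infinite)
qed

lift_definition Vop :: "nat \<Rightarrow> 'k::field rop" is pivot by (rule row_finite_pivot)

lemma mat_eqI:
  assumes "\<And>S T. finite S \<Longrightarrow> mat A S T = mat B S T"
  shows "A = B"
proof -
  have "mat A S T = mat B S T" for S T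
    using assms row_finite_mat[of A] row_finite_mat[of B] by (metis row_finite_def)
  then have "mat A = mat B" by (simp add: fun_eq_iff)
  then show ?thesis by (simp add: mat_inject)
qed

text \<open>On a row bounded by K, the summand k = 0 is split off from the first K+1 summands; the
  others are x_i x_{i+1} times the first K summands of v_{i+3}.\<close>

lemma Vop_rec: "(Vop i :: 'k::field rop) = Dop i + Xop i * Xop (Suc i) * Vop (i + 3)"
proof (rule mat_eqI)
  fix S T :: "nat set" assume "finite S"
  then obtain K where K: "S \<subseteq> {..<K}" using finite_nat_iff_bounded by auto
  then have K': "S \<subseteq> {..<Suc K}" by auto
  have "mat (Vop i :: 'k rop) S = mat (\<Sum>k<Suc K. Vop_term i k) S"
    by (simp only: Vop.rep_eq pivot_eq_sum[OF K'])
  also have "(\<Sum>k<Suc K. Vop_term i k :: 'k rop) = Dop i + Xop i * Xop (Suc i) * (\<Sum>k<K. Vop_term (i + 3) k)"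
    by (simp only: sum.lessThan_Suc_shift Vop_term_0 Vop_term_Suc sum_distrib_left)
  also have "mat \<dots> S = mat (Dop i + Xop i * Xop (Suc i) * Vop (i + 3)) S"
    unfolding mat_add fun_eq_iff
    by (subst mat_times_cong[of "Vop (i + 3)" _ "\<Sum>k<K. Vop_term (i + 3) k"])
      (simp_all add: Vop.rep_eq pivot_eq_sum[OF K])
  finally show "mat (Vop i) S T = mat (Dop i + Xop i * Xop (Suc i) * Vop (i + 3) :: 'k rop) S T" by simp
qed

lemma mat_Vop_zero: "S \<subseteq> {..<i} \<Longrightarrow> mat (Vop i) S = (\<lambda>T. 0)"
  by (subst Vop.rep_eq, subst pivot_eq_sum) (auto simp: mat_sum mat_Vop_term_zero fun_eq_iff intro!: sum.neutral mat_Vop_term_zero[THEN fun_cong])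

lemma Xop_row: "mat A (insert j S) = (\<lambda>T. 0) \<Longrightarrow> mat (A * Xop j) S = (\<lambda>T. 0)"
  by transfer (auto simp: ocomp_lmul fun_eq_iff)

lemma Dop_row: "mat A (S - {j}) = (\<lambda>T. 0) \<Longrightarrow> mat (A * Dop j) S = (\<lambda>T. 0)"
  by transfer (auto simp: ocomp_pder fun_eq_iff)

text \<open>The recursion for \<open>Vop\<close> runs upwards; it terminates on each row \<open>S\<close> because \<open>Vop i\<close>
  annihilates \<open>x_S\<close> as soon as \<open>i\<close> exceeds all elements of \<open>S\<close>.\<close>

lemma anticommute_Vop:
  fixes Y :: "'k::field rop"
  assumes Y: "\<And>k. k \<ge> i \<Longrightarrow> Y * Xop k = - (Xop k * Y)" "\<And>k. k \<ge> i \<Longrightarrow> Y * Dop k = - (Dop k * Y)"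
    and row: "\<And>k S. S \<subseteq> {..<k} \<Longrightarrow> i \<le> k \<Longrightarrow> mat (Vop k * Y) S = (\<lambda>T. 0)"
  shows "Vop i * Y = - (Y * Vop i)"
proof -
  have "Vop i * Y + Y * Vop i = 0"
  proof (rule mat_eqI)
    fix S T :: "nat set" assume "finite S"
    then obtain M where M: "S \<subseteq> {..<M}" using finite_nat_iff_bounded by auto
    have "mat (Vop k * Y + Y * Vop k) S = (\<lambda>T. 0)" if "i \<le> k" for k
      using that
    proof (induction "M - k" arbitrary: k rule: less_induct)
      case less
      show ?case
      proof (cases "M \<le> k")
        case True
        with M have "S \<subseteq> {..<k}" by auto
        with row less.prems mat_times_zero[OF mat_Vop_zero] show ?thesis
          by (simp add: fun_eq_iff mat_add)
      next
        case False
        then have IH: "mat (Vop (k + 3) * Y + Y * Vop (k + 3)) S = (\<lambda>T. 0)"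
          using less by simp
        have "Y * (Xop k * Xop (Suc k) * Vop (k + 3)) = Xop k * Xop (Suc k) * (Y * Vop (k + 3))"
          using Y(1)[of k] Y(1)[of "Suc k"] less.prems
          by (simp add: mult.assoc[symmetric]) (simp add: mult.assoc)
        then have "Vop k * Y + Y * Vop k = Xop k * Xop (Suc k) * (Vop (k + 3) * Y + Y * Vop (k + 3))"
          using Y(2)[OF less.prems] by (subst (1 2) Vop_rec) (simp add: algebra_simps)
        with mat_times_zero[OF IH] show ?thesis by simp
      qed
    qed
    from this[of i] show "mat (Vop i * Y + Y * Vop i) S T = mat 0 S T" by (simp add: mat_zero)
  qed
  then show ?thesis by (simp add: eq_neg_iff_add_eq_0)
qed

text \<open>Multiplying by x_j with j < i <= k keeps all letters of the row below k, so
  \<open>Vop k\<close> still annihilates it, as \<open>anticommute_Vop\<close> demands.\<close>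

lemma Vop_Xop: "j < i \<Longrightarrow> Vop i * Xop j = - (Xop j * Vop i)"
  by (rule anticommute_Vop) (auto intro!: Xop_Xop Xop_row mat_Vop_zero simp: Dop_Xop)

lemma Vop_Dop: "j < i \<Longrightarrow> Vop i * Dop j = - (Dop j * Vop i)"
  by (rule anticommute_Vop) (auto intro!: Dop_Dop Dop_row mat_Vop_zero simp: Dop_Xop)

text \<open>Anticommutation and nilpotency are restated for right-nested products, where the plain
  equations do not match as rewrite rules.\<close>

lemma swap_assoc: "(a::'a::ring_1) * b = - (b * a) \<Longrightarrow> a * (b * c) = - (b * (a * c))"
  by (metis mult.assoc mult_minus_left)

lemma nil_assoc: "(a::'a::ring_1) * a = 0 \<Longrightarrow> a * (a * c) = 0"
  by (metis mult.assoc mult_zero_left)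

text \<open>The relations from which all later identities are derived; working in an abstract ring
  keeps matrices out of the algebra.\<close>

locale pivot_algebra =
  fixes X D V :: "nat \<Rightarrow> 'a::ring_1"
  assumes X_X: "X i * X j = - (X j * X i)"
    and X_sq: "X i * X i = 0"
    and D_sq: "D i * D i = 0"
    and D_X: "i \<noteq> j \<Longrightarrow> D i * X j = - (X j * D i)"
    and D_X_same: "D i * X i = 1 - X i * D i"
    and V_X: "j < i \<Longrightarrow> V i * X j = - (X j * V i)"
    and V_D: "j < i \<Longrightarrow> V i * D j = - (D j * V i)"
    and V_rec: "V i = D i + X i * X (Suc i) * V (i + 3)"
begin

lemmas X_nil = X_sq X_sq[THEN nil_assoc]

section \<open>Commutation relations of the pivot elements\<close>

lemma X_V: "X i * V i = X i * D i"
  by (subst V_rec) (simp add: distrib_left mult.assoc X_nil)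

lemma V_X_same: "V i * X i = 1 - X i * V i"
proof -
  have s: "X (Suc i) * X i = - (X i * X (Suc i))" by (rule X_X)
  have v: "V (i + 3) * X i = - (X i * V (i + 3))" by (rule V_X) simp
  have "V i * X i = D i * X i + X i * X (Suc i) * V (i + 3) * X i"
    by (subst V_rec) (simp add: distrib_right)
  also have "X i * X (Suc i) * V (i + 3) * X i = 0"
    using v swap_assoc[OF s] by (simp add: mult.assoc X_nil)
  finally show ?thesis by (simp add: D_X_same X_V)
qed

lemma V_X_Suc: "V i * X (Suc i) = - (X (Suc i) * V i)"
proof -
  have s: "X (Suc i) * X i = - (X i * X (Suc i))" by (rule X_X)
  have v: "V (i + 3) * X (Suc i) = - (X (Suc i) * V (i + 3))" by (rule V_X) simp
  have d: "D i * X (Suc i) = - (X (Suc i) * D i)" by (rule D_X) simp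
  show ?thesis
    by (subst (1 2) V_rec)
      (use v d in \<open>simp add: algebra_simps mult.assoc X_nil swap_assoc[OF s, simplified]\<close>)
qed

lemma V_X_gt:
  assumes "i + 2 \<le> j"
  shows "V i * X j + X j * V i = X i * X (Suc i) * (V (i + 3) * X j + X j * V (i + 3))"
proof -
  have s: "X j * X i = - (X i * X j)" "X j * X (Suc i) = - (X (Suc i) * X j)" by (rule X_X)+
  have d: "D i * X j = - (X j * D i)" by (rule D_X) (use assms in simp)
  show ?thesis
    by (subst (1 2) V_rec)
      (use s d in \<open>simp add: algebra_simps mult.assoc s[THEN swap_assoc, simplified]\<close>)
qed

text \<open>In the square of d_i + x_i x_{i+1} v_{i+3}, both d_i^2 and the square of the tail
  vanish, and d_i x_i = 1 - x_i d_i in the mixed terms leaves x_{i+1} v_{i+3}. Being a plain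
  product, this holds in every characteristic.\<close>

lemma V_sq: "V i * V i = X (Suc i) * V (i + 3)"
proof -
  let ?W = "V (i + 3)"
  have s: "X (Suc i) * X i = - (X i * X (Suc i))" by (rule X_X)
  have v: "?W * X i = - (X i * ?W)" "?W * X (Suc i) = - (X (Suc i) * ?W)" "?W * D i = - (D i * ?W)"
    by (rule V_X V_D, simp)+
  have d: "D i * X (Suc i) = - (X (Suc i) * D i)" by (rule D_X) simp
  have dd: "D i * (X i * c) = c - X i * (D i * c)" for c :: "'a"
    by (metis D_X_same left_diff_distrib mult.assoc mult_1)
  show ?thesis
    by (subst (1 2) V_rec)
      (use v d in \<open>simp add: distrib_left distrib_right mult.assoc X_nil D_sq dd
         swap_assoc[OF s, simplified] swap_assoc[OF d, simplified] v[THEN swap_assoc, simplified]\<close>)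
qed

lemma V_V_gt:
  assumes "i + 2 \<le> m"
  shows "V i * V m + V m * V i = X i * X (Suc i) * (V (i + 3) * V m + V m * V (i + 3))"
proof -
  have v: "V m * X i = - (X i * V m)" "V m * X (Suc i) = - (X (Suc i) * V m)"
    "V m * D i = - (D i * V m)"
    using assms by (auto intro: V_X V_D)
  show ?thesis
    by (subst (1 2) V_rec)
      (use v in \<open>simp add: algebra_simps mult.assoc v[THEN swap_assoc, simplified]\<close>)
qed

lemma V_V_Suc: "V i * V (Suc i) + V (Suc i) * V i = - (X i * V (i + 3))"
proof -
  let ?U = "V (Suc i)" and ?W = "V (i + 3)"
  have v: "?U * X i = - (X i * ?U)" "?U * D i = - (D i * ?U)"
    by (auto intro: V_X V_D)
  have u: "?U * (X (Suc i) * c) = c - X (Suc i) * (?U * c)" for c :: "'a"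
    by (metis V_X_same left_diff_distrib mult.assoc mult_1)
  \<comment> \<open>The bracket of v_{i+1} and v_{i+3} starts with x_{i+1}, so another x_{i+1} kills
    it.\<close>
  have "X (Suc i) * (?U * ?W + ?W * ?U) = 0"
    using V_V_gt[of "Suc i" "i + 3"] by (simp add: mult.assoc X_nil)
  then have z: "X (Suc i) * (?W * ?U) = - (X (Suc i) * (?U * ?W))"
    by (simp add: distrib_left eq_neg_iff_add_eq_0 add.commute)
  show ?thesis
    by (subst (1 2) V_rec[of i])
      (use v z in \<open>simp add: distrib_left distrib_right right_diff_distrib mult.assoc u v[THEN swap_assoc, simplified]\<close>)
qed
end

section \<open>Weights\<close>

text \<open>\<open>wt i\<close> is the length of \<open>v_i\<close> as a commutator in \<open>v_0, v_1, v_2\<close>; accordingly \<open>x_i\<close> has weight \<open>- wt i\<close>.\<close>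

fun wt :: "nat \<Rightarrow> nat" where
  "wt 0 = 1"
| "wt (Suc 0) = 1"
| "wt (Suc (Suc 0)) = 1"
| "wt (Suc (Suc (Suc i))) = 2 * wt i + wt (Suc i)"

lemma wt_add_3: "wt (i + 3) = 2 * wt i + wt (Suc i)"
  by (simp add: numeral_3_eq_3)

text \<open>Hence the parity of a weight is the superparity, and every sign can be read off from
  weights.\<close>

lemma odd_wt [simp]: "odd (wt i)"
  by (induction i rule: wt.induct) auto

text \<open>Adding 1 turns the partial sums into a solution of the same homogeneous recursion as
  \<open>wt\<close>.\<close>

lemma sum_wt_add_3: "(\<Sum>j<n + 3. wt j) + 1 = 2 * ((\<Sum>j<n. wt j) + 1) + ((\<Sum>j<Suc n. wt j) + 1)"
  by (induction n) (simp_all add: numeral_3_eq_3)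

lemma nat_induct3:
  assumes "P 0" "P (Suc 0)" "P (Suc (Suc 0))" "\<And>n. P n \<Longrightarrow> P (Suc n) \<Longrightarrow> P (n + 3)"
  shows "P n"
  using assms(1-3)
proof (induction n rule: less_induct)
  case (less n)
  show ?case
  proof (cases "n < 3")
    case True
    then have "n = 0 \<or> n = Suc 0 \<or> n = Suc (Suc 0)" by auto
    with assms(1-3) show ?thesis by auto
  next
    case False
    then obtain m where m: "n = m + 3" by (metis add.commute le_Suc_ex not_less)
    with assms less have "P m" "P (Suc m)" by auto
    with assms(4) m show ?thesis by simp
  qed
qed

text \<open>With N = n + 2 this bounds the weight of x_0 ... x_{N-3}, the largest coefficient of v_N
  of the first kind.\<close>

lemma sum_wt_bound: "11 * (\<Sum>j<n. wt j) \<le> 10 * wt (n + 2)"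
proof (cases "n < 3")
  case True
  then have "n = 0 \<or> n = Suc 0 \<or> n = Suc (Suc 0)" by auto
  then show ?thesis by (auto simp: eval_nat_numeral)
next
  case False
  then obtain m where m: "n = m + 3" by (metis add.commute le_Suc_ex not_less)
  \<comment> \<open>The extra 1 makes the inequality compatible with the recursion, so three base
    cases suffice. It fails for n = 0 and n = 2, hence the case split. For m = 2 it reads 110 <=
    110, which fixes the ratio 10/11.\<close>
  have "11 * ((\<Sum>j<m + 3. wt j) + 1) \<le> 10 * wt (m + 5)"
  proof (induction m rule: nat_induct3)
    case (4 m)
    have "wt (m + 3 + 5) = 2 * wt (m + 5) + wt (Suc m + 5)"
      using wt_add_3[of "m + 5"] by (simp add: add_ac)
    moreover have "11 * ((\<Sum>j<m + 3 + 3. wt j) + 1) =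
      2 * (11 * ((\<Sum>j<m + 3. wt j) + 1)) + 11 * ((\<Sum>j<Suc m + 3. wt j) + 1)"
      unfolding sum_wt_add_3[of "m + 3"] by simp
    ultimately show ?case using 4 by linarith
  qed (simp_all add: eval_nat_numeral)
  with m show ?thesis by (simp add: add_ac)
qed

text \<open>The same bound for the second kind: with N = n + 4 it concerns x_{N-2} times x_0 ...
  x_{N-5}.\<close>

lemma sum_wt_bound': "11 * (wt (n + 2) + (\<Sum>j<n. wt j)) \<le> 10 * wt (n + 4)"
proof (cases "n < 2")
  case True
  then have "n = 0 \<or> n = Suc 0" by auto
  then show ?thesis by (auto simp: eval_nat_numeral)
next
  case False
  then obtain m where m: "n = m + 2" by (metis add.commute le_Suc_ex not_less)
  have "11 * (wt (m + 4) + ((\<Sum>j<m + 2. wt j) + 1)) \<le> 10 * wt (m + 6)"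
  proof (induction m rule: nat_induct3)
    case (4 m)
    have 1: "wt (m + 3 + 6) = 2 * wt (m + 6) + wt (Suc m + 6)"
      using wt_add_3[of "m + 6"] by (simp add: add_ac)
    have 2: "wt (m + 3 + 4) = 2 * wt (m + 4) + wt (Suc m + 4)"
      using wt_add_3[of "m + 4"] by (simp add: add_ac)
    have 3: "m + 3 + 2 = m + 2 + 3" by simp
    have "11 * (wt (m + 3 + 4) + ((\<Sum>j<m + 3 + 2. wt j) + 1)) =
      2 * (11 * (wt (m + 4) + ((\<Sum>j<m + 2. wt j) + 1))) +
      11 * (wt (Suc m + 4) + ((\<Sum>j<Suc m + 2. wt j) + 1))"
      unfolding 2 3 sum_wt_add_3[of "m + 2"] by simp
    then show ?case using 4 1 by linarith
  qed (simp_all add: eval_nat_numeral)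
  moreover have "m + 4 = n + 2" "m + 6 = n + 4" "m + 2 = n" using m by simp_all
  ultimately have "11 * (wt (n + 2) + ((\<Sum>j<n. wt j) + 1)) \<le> 10 * wt (n + 4)" by (simp only:)
  then show ?thesis by simp
qed

section \<open>Superbrackets of monomials\<close>

text \<open>The exponent is an integer because it is usually a difference of weights such as
  \<open>int (wt N) - w\<close>.\<close>

definition sg :: "int \<Rightarrow> 'a::ring_1" where
  "sg u = (if even u then 1 else - 1)"

lemma sg_parity: "even (u - v) \<Longrightarrow> sg u = sg v"
  by (auto simp: sg_def)

lemma sg_mult_assoc: "sg u * (sg v * a) = sg (u + v) * a"
  by (auto simp: sg_def)

text \<open>\<open>NO_MATCH\<close> keeps the simplifier from exchanging two signs forever.\<close>

lemma sg_comm_assoc: "NO_MATCH (sg v) a \<Longrightarrow> a * (sg u * b) = sg u * (a * b)"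
  by (auto simp: sg_def)

lemma sg_uminus: "- sg u = sg (u + 1)"
  by (auto simp: sg_def)

context pivot_algebra
begin

text \<open>The integral combinations of monomials of weight \<open>- u\<close> in \<open>x_0, ..., x_{k-1}\<close>. As all \<open>wt i\<close> are
  odd, \<open>u\<close> also determines the parity.\<close>

primrec E :: "nat \<Rightarrow> int \<Rightarrow> 'a set" where
  "E 0 u = (if u = 0 then range of_int else {0})"
| "E (Suc k) u = {p + X k * q | p q. p \<in> E k u \<and> q \<in> E k (u - int (wt k))}"

lemma E_SucI: "p \<in> E k u \<Longrightarrow> q \<in> E k (u - int (wt k)) \<Longrightarrow> p + X k * q \<in> E (Suc k) u"
  by auto

lemma E_zero: "0 \<in> E k u"
proof (induction k arbitrary: u)
  case 0
  show ?case by (auto intro: range_eqI[of _ _ 0])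
next
  case (Suc k)
  show ?case using E_SucI[OF Suc Suc] by simp
qed

lemma E_Suc: "p \<in> E k u \<Longrightarrow> p \<in> E (Suc k) u"
  using E_SucI[OF _ E_zero] by simp

lemma E_mono: "p \<in> E k u \<Longrightarrow> k \<le> l \<Longrightarrow> p \<in> E l u"
proof -
  assume p: "p \<in> E k u" and "k \<le> l"
  from this(2) show ?thesis by (induction l rule: dec_induct) (use p E_Suc in blast)+
qed

lemma E_add: "p \<in> E k u \<Longrightarrow> q \<in> E k u \<Longrightarrow> p + q \<in> E k u"
proof (induction k arbitrary: p q u)
  case 0
  then show ?case by (auto split: if_splits simp flip: of_int_add)
next
  case (Suc k)
  then obtain p0 p1 q0 q1 where pq: "p = p0 + X k * p1" "q = q0 + X k * q1"
    "p0 \<in> E k u" "q0 \<in> E k u" "p1 \<in> E k (u - int (wt k))" "q1 \<in> E k (u - int (wt k))" by auto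
  then have "p + q = (p0 + q0) + X k * (p1 + q1)" by (simp add: algebra_simps)
  with pq Suc.IH show ?case by (metis E_SucI)
qed

lemma E_of_int_mult: "p \<in> E k u \<Longrightarrow> of_int n * p \<in> E k u"
proof (induction k arbitrary: p u)
  case 0
  then show ?case by (auto split: if_splits simp flip: of_int_mult)
next
  case (Suc k)
  then obtain p0 p1 where p: "p = p0 + X k * p1" "p0 \<in> E k u" "p1 \<in> E k (u - int (wt k))" by auto
  then have "of_int n * p = of_int n * p0 + X k * (of_int n * p1)"
    by (simp add: distrib_left) (metis mult.assoc mult_of_int_commute)
  with p Suc.IH show ?case by (metis E_SucI)
qed

lemma E_uminus: "p \<in> E k u \<Longrightarrow> - p \<in> E k u"
  using E_of_int_mult[of p k u "-1"] by simp

lemma E_diff: "p \<in> E k u \<Longrightarrow> q \<in> E k u \<Longrightarrow> p - q \<in> E k u"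
  using E_add[OF _ E_uminus] by fastforce

lemma E_one: "1 \<in> E k 0"
  by (rule E_mono[of _ 0]) (auto intro: range_eqI[of _ _ 1])

lemma E_X_mult: "p \<in> E k u \<Longrightarrow> j < k \<Longrightarrow> X j * p \<in> E k (u + int (wt j))"
proof (induction k arbitrary: p u)
  case (Suc k)
  then obtain p0 p1 where p: "p = p0 + X k * p1" "p0 \<in> E k u" "p1 \<in> E k (u - int (wt k))" by auto
  show ?case
  proof (cases "j = k")
    case True
    with p have "X j * p = 0 + X k * p0" by (simp add: distrib_left X_nil)
    with p True E_SucI[OF E_zero, of p0 k "u + int (wt k)"] show ?thesis by simp
  next
    case False
    with Suc p have "X j * p0 \<in> E k (u + int (wt j))" "X j * p1 \<in> E k (u - int (wt k) + int (wt j))"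
      by auto
    moreover have "X j * p = X j * p0 + X k * - (X j * p1)"
      using p swap_assoc[OF X_X[of j k]] by (simp add: distrib_left)
    moreover from calculation have "X j * p0 + X k * - (X j * p1) \<in> E (Suc k) (u + int (wt j))"
      by (intro E_SucI E_uminus) (simp_all add: algebra_simps)
    ultimately show ?thesis by metis
  qed
qed simp

lemma E_X: "j < k \<Longrightarrow> X j \<in> E k (int (wt j))"
  using E_X_mult[OF E_one] by simp

text \<open>Two bounds k <= l are needed because the induction removes letters from p only, while q
  keeps all of its letters.\<close>

lemma E_mult_aux: "p \<in> E k u \<Longrightarrow> k \<le> l \<Longrightarrow> q \<in> E l v \<Longrightarrow> p * q \<in> E l (u + v)"
proof (induction k arbitrary: p u)
  case 0
  then show ?case by (auto split: if_splits simp: E_of_int_mult E_zero)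
next
  case (Suc k)
  then obtain p0 p1 where p: "p = p0 + X k * p1" "p0 \<in> E k u" "p1 \<in> E k (u - int (wt k))" by auto
  have "p0 * q \<in> E l (u + v)" "p1 * q \<in> E l (u - int (wt k) + v)"
    using Suc p by auto
  from E_add[OF this(1), of "X k * (p1 * q)"] E_X_mult[OF this(2), of k] Suc.prems p show ?case
    by (simp add: distrib_right mult.assoc)
qed

lemma E_mult: "p \<in> E k u \<Longrightarrow> q \<in> E k v \<Longrightarrow> p * q \<in> E k (u + v)"
  by (rule E_mult_aux) auto

lemma E_commute_X: "p \<in> E k u \<Longrightarrow> p * X j = sg u * (X j * p)"
proof (induction k arbitrary: p u)
  case 0
  then show ?case by (auto split: if_splits simp: sg_def mult_of_int_commute)
next
  case (Suc k)
  then obtain p0 p1 where p: "p = p0 + X k * p1" "p0 \<in> E k u" "p1 \<in> E k (u - int (wt k))" by auto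
  have "(X k * p1) * X j = sg (u - int (wt k)) * (X k * (X j * p1))"
    using Suc.IH[OF p(3)] by (simp add: mult.assoc sg_comm_assoc)
  also have "\<dots> = sg u * (X j * (X k * p1))"
    using swap_assoc[OF X_X[of k j]] by (simp add: sg_def)
  finally show ?case using p Suc.IH[OF p(2)] by (simp add: algebra_simps)
qed

lemma E_commute: "p \<in> E k u \<Longrightarrow> q \<in> E l v \<Longrightarrow> q * p = sg (u * v) * (p * q)"
proof (induction k arbitrary: p u)
  case 0
  then show ?case by (auto split: if_splits simp: sg_def mult_of_int_commute)
next
  case (Suc k)
  then obtain p0 p1 where p: "p = p0 + X k * p1" "p0 \<in> E k u" "p1 \<in> E k (u - int (wt k))" by auto
  have "q * (X k * p1) = sg v * (X k * (q * p1))"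
    using E_commute_X[OF Suc.prems(2)] by (metis mult.assoc)
  also have "\<dots> = sg (v + (u - int (wt k)) * v) * (X k * (p1 * q))"
    using Suc.IH[OF p(3) Suc.prems(2)] by (simp add: sg_comm_assoc sg_mult_assoc)
  also have "sg (v + (u - int (wt k)) * v) = (sg (u * v) :: 'a)"
    by (rule sg_parity) auto
  finally show ?case using p Suc.IH[OF p(2) Suc.prems(2)] by (simp add: algebra_simps)
qed

section \<open>Action of the pivot elements on coefficients\<close>

lemma V_E: "p \<in> E k u \<Longrightarrow> k \<le> n \<Longrightarrow> V n * p = sg u * (p * V n)"
proof (induction k arbitrary: p u)
  case 0
  then show ?case by (auto split: if_splits simp: sg_def mult_of_int_commute)
next
  case (Suc k)
  then obtain p0 p1 where p: "p = p0 + X k * p1" "p0 \<in> E k u" "p1 \<in> E k (u - int (wt k))" by auto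
  have IH: "V n * p0 = sg u * (p0 * V n)" "V n * p1 = sg (u - int (wt k)) * (p1 * V n)"
    using Suc p by auto
  have "V n * (X k * p1) = - (X k * (V n * p1))"
    using swap_assoc[OF V_X[of k n]] Suc.prems by simp
  also have "\<dots> = sg u * (X k * p1 * V n)"
    unfolding IH by (simp add: sg_def mult.assoc)
  finally show ?case using p IH by (simp add: algebra_simps)
qed

text \<open>Unrolled, v_n(x_k) is 0, or 1 for k = n, or x_n x_{n+1} x_{n+3} x_{n+4} ... x_{k-3}
  x_{k-2} for k - n a positive multiple of 3. So x_{k-1} never occurs, whence the bound
  \<open>k - 1\<close>.\<close>

lemma V_X_E: "V n * X k + X k * V n \<in> E (k - 1) (int (wt k) - int (wt n))"
proof (induction "k - n" arbitrary: n rule: less_induct)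
  case less
  consider "k < n" | "k = n" | "k = Suc n" | "n + 2 = k" | "n + 3 \<le> k" by linarith
  then show ?case
  proof cases
    case 5
    then have IH: "V (n + 3) * X k + X k * V (n + 3) \<in> E (k - 1) (int (wt k) - int (wt (n + 3)))"
      by (intro less) simp
    from 5 have "X n * (X (Suc n) * (V (n + 3) * X k + X k * V (n + 3)))
        \<in> E (k - 1) (int (wt k) - int (wt (n + 3)) + int (wt (Suc n)) + int (wt n))"
      by (intro E_X_mult IH) auto
    moreover have "int (wt k) - int (wt (n + 3)) + int (wt (Suc n)) + int (wt n) = int (wt k) - int (wt n)"
      by (simp add: wt_add_3)
    ultimately show ?thesis using V_X_gt[of n k] 5 by (simp add: mult.assoc)
  qed (use V_X_gt[of n k] V_X[of k "n + 3"] in \<open>auto simp: V_X V_X_same V_X_Suc E_zero E_one\<close>)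
qed

text \<open>The supercommutator of v_n with multiplication by p, that is, multiplication by v_n(p);
  u supplies the parity of p.\<close>

definition sder :: "nat \<Rightarrow> int \<Rightarrow> 'a \<Rightarrow> 'a" where
  "sder n u p = V n * p - sg u * (p * V n)"

lemma sder_add: "sder n u (p + q) = sder n u p + sder n u q"
  by (simp add: sder_def algebra_simps)

lemma sder_X:
  "sder n u (X k * q) = (V n * X k + X k * V n) * q - X k * sder n (u - int (wt k)) q"
  by (simp add: sder_def sg_def algebra_simps)

lemma sder_eq_0: "p \<in> E k u \<Longrightarrow> k \<le> n \<Longrightarrow> sder n u p = 0"
  by (simp add: sder_def V_E)

lemma sder_E: "p \<in> E k u \<Longrightarrow> sder n u p \<in> E k (u - int (wt n))"
proof (induction k arbitrary: p u)
  case 0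
  then show ?case using sder_eq_0 E_zero by (metis le0)
next
  case (Suc k)
  then obtain p0 p1 where p: "p = p0 + X k * p1" "p0 \<in> E k u" "p1 \<in> E k (u - int (wt k))" by auto
  have "sder n u p0 \<in> E (Suc k) (u - int (wt n))"
    using Suc.IH[OF p(2)] by (rule E_Suc)
  moreover have "(V n * X k + X k * V n) * p1 \<in> E (Suc k) (int (wt k) - int (wt n) + (u - int (wt k)))"
    by (rule E_mult[OF E_mono[OF V_X_E] E_mono[OF p(3)]]) auto
  moreover have "X k * sder n (u - int (wt k)) p1 \<in> E (Suc k) (u - int (wt k) - int (wt n) + int (wt k))"
    by (rule E_X_mult[OF E_Suc[OF Suc.IH[OF p(3)]]]) simp
  ultimately show ?case unfolding p(1) sder_add sder_X
    by (intro E_add E_diff) (simp_all add: algebra_simps del: E.simps)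
qed

end

context pivot_algebra
begin

text \<open>The coefficients of \<open>v_N\<close> that occur in the Lie superalgebra: monomials in \<open>x_0, ..., x_{N-3}\<close>,
  or \<open>x_{N-2}\<close> times a monomial in \<open>x_0, ..., x_{N-5}\<close>.\<close>

definition C :: "nat \<Rightarrow> int \<Rightarrow> 'a set" where
  "C N u = {p + X (N - 2) * q | p q. p \<in> E (N - 2) u \<and>
     (if N < 3 then q = 0 else q \<in> E (N - 4) (u - int (wt (N - 2))))}"

lemma C_E: "p \<in> E (N - 2) u \<Longrightarrow> p \<in> C N u"
  unfolding C_def by (rule CollectI, rule exI[of _ p], rule exI[of _ 0]) (simp add: E_zero)

lemma C_X: "q \<in> E (N - 4) (u - int (wt (N - 2))) \<Longrightarrow> 3 \<le> N \<Longrightarrow> X (N - 2) * q \<in> C N u"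
  unfolding C_def by (rule CollectI, rule exI[of _ 0], rule exI[of _ q]) (simp add: E_zero)

lemma C_cases:
  assumes "c \<in> C N u"
  obtains (E) p q where "c = p + X (N - 2) * q" "p \<in> E (N - 2) u" "q = 0"
  | (X) p q where "c = p + X (N - 2) * q" "p \<in> E (N - 2) u" "3 \<le> N"
     "q \<in> E (N - 4) (u - int (wt (N - 2)))"
  using assms unfolding C_def by (auto split: if_splits)

lemma C_add: "c \<in> C N u \<Longrightarrow> d \<in> C N u \<Longrightarrow> c + d \<in> C N u"
proof -
  assume "c \<in> C N u" "d \<in> C N u"
  then obtain p q p' q' where pq: "c = p + X (N - 2) * q" "p \<in> E (N - 2) u"
    "if N < 3 then q = 0 else q \<in> E (N - 4) (u - int (wt (N - 2)))"
    "d = p' + X (N - 2) * q'" "p' \<in> E (N - 2) u"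
    "if N < 3 then q' = 0 else q' \<in> E (N - 4) (u - int (wt (N - 2)))"
    unfolding C_def by blast
  then have "c + d = (p + p') + X (N - 2) * (q + q')" by (simp add: algebra_simps)
  moreover have "if N < 3 then q + q' = 0 else q + q' \<in> E (N - 4) (u - int (wt (N - 2)))"
    using pq by (auto simp: E_add split: if_splits)
  ultimately show ?thesis unfolding C_def using pq E_add by blast
qed

lemma C_subset_E:
  assumes "c \<in> C N u" shows "c \<in> E (N - 1) u"
  using assms
proof (cases rule: C_cases)
  case (E p q)
  then show ?thesis using E_mono[of p "N - 2" u "N - 1"] by simp
next
  case (X p q)
  have "X (N - 2) * q \<in> E (N - 1) (u - int (wt (N - 2)) + int (wt (N - 2)))"
    by (rule E_X_mult[OF E_mono[OF X(4)]]) (use X in auto)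
  then show ?thesis using E_add[OF E_mono[OF X(2)], of "N - 1"] X(1) by simp
qed

lemma C_uminus:
  assumes "c \<in> C N u" shows "- c \<in> C N u"
  using assms
proof (cases rule: C_cases)
  case (E p q)
  then show ?thesis using C_E[OF E_uminus] by simp
next
  case (X p q)
  have "- p + X (N - 2) * - q \<in> C N u"
    using X by (intro C_add C_E C_X E_uminus) auto
  with X show ?thesis by simp
qed

lemma C_sg: "c \<in> C N u \<Longrightarrow> sg v * c \<in> C N u"
  by (simp add: sg_def C_uminus)

text \<open>Here r is the coefficient of v_n in a bracket. Differentiating p gives 0 unless n < N-2,
  so no letter beyond x_{N-3} appears. For x_{N-2} q, differentiating x_{N-2} removes that letter
  and yields the first kind; differentiating q gives 0 unless n < N-4, and then r fits below x_{N-4}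
  too.\<close>

lemma sder_C:
  assumes c: "c \<in> C N u" and r: "r \<in> E (n - 1) v" and n: "n < N"
  shows "r * sder n u c \<in> C N (u + v - int (wt n))"
proof -
  have *: "r * sder n u p \<in> C N (u + v - int (wt n))" if p: "p \<in> E (N - 2) u" for p
  proof (cases "N - 2 \<le> n")
    case True
    then show ?thesis using sder_eq_0[OF p] C_E[OF E_zero] by simp
  next
    case False
    then have "r * sder n u p \<in> E (N - 2) (v + (u - int (wt n)))"
      by (intro E_mult sder_E p E_mono[OF r]) simp
    then show ?thesis by (intro C_E) (simp add: algebra_simps)
  qed
  from c show ?thesis
  proof (cases rule: C_cases)
    case (E p q)
    with * show ?thesis by simp
  next
    case (X p q)
    let ?u = "u - int (wt (N - 2))"
    let ?z = "V n * X (N - 2) + X (N - 2) * V n"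
    have "r * (?z * q) \<in> C N (u + v - int (wt n))"
    proof (cases "n = N - 1")
      case True
      then have "?z = 0" using V_X[of "N - 2" n] X by simp
      then show ?thesis using C_E[OF E_zero] by simp
    next
      case False
      with n have "n - 1 \<le> N - 2" by simp
      moreover have "?z \<in> E (N - 2) (int (wt (N - 2)) - int (wt n))"
        by (rule E_mono[OF V_X_E]) simp
      ultimately have "r * (?z * q) \<in> E (N - 2) (v + (int (wt (N - 2)) - int (wt n) + ?u))"
        by (intro E_mult E_mono[OF r] E_mono[OF X(4)]) auto
      then show ?thesis by (intro C_E) (simp add: algebra_simps)
    qed
    moreover have "r * (X (N - 2) * sder n ?u q) \<in> C N (u + v - int (wt n))"
    proof (cases "N - 4 \<le> n")
      case True
      then show ?thesis using sder_eq_0[OF X(4)] C_E[OF E_zero] by simp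
    next
      case False
      then have "r * sder n ?u q \<in> E (N - 4) (v + (?u - int (wt n)))"
        by (intro E_mult sder_E X E_mono[OF r]) simp
      then have "X (N - 2) * (r * sder n ?u q) \<in> C N (u + v - int (wt n))"
        using X by (intro C_X) (simp_all add: algebra_simps)
      moreover have "r * (X (N - 2) * sder n ?u q) = sg v * (X (N - 2) * (r * sder n ?u q))"
        using E_commute_X[OF r] by (metis mult.assoc)
      ultimately show ?thesis by (simp add: C_sg)
    qed
    moreover have "r * sder n u c = r * sder n u p + (r * (?z * q) + - (r * (X (N - 2) * sder n ?u q)))"
      unfolding X(1) sder_add sder_X by (simp add: algebra_simps)
    ultimately show ?thesis using *[OF X(2)] by (simp only:) (intro C_add C_uminus)
  qed
qed

text \<open>The weight-w part of the closed family: a coefficient of weight -u in front of v_N gives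
  weight \<open>wt N\<close> - u = w. Integer multiples are already contained in
  \<open>C\<close>.\<close>

inductive_set W :: "int \<Rightarrow> 'a set" for w :: int where
  W_zero: "0 \<in> W w"
| W_gen: "c \<in> C N (int (wt N) - w) \<Longrightarrow> c * V N \<in> W w"
| W_add: "a \<in> W w \<Longrightarrow> b \<in> W w \<Longrightarrow> a + b \<in> W w"

lemma W_uminus: "a \<in> W w \<Longrightarrow> - a \<in> W w"
proof (induction rule: W.induct)
  case (W_gen c N)
  then show ?case using W.W_gen[OF C_uminus] by fastforce
next
  case (W_add a b)
  then show ?case using W.W_add[of "- a" w "- b"] by (simp add: add.commute)
qed (simp add: W.W_zero)

lemma W_sg: "a \<in> W w \<Longrightarrow> sg u * a \<in> W w"
  by (simp add: sg_def W_uminus)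

text \<open>The result is x_{m+1} p v_{m+3} up to sign. With N = m + 3 the new letter is x_{N-2} and
  p lies in \<open>E (N - 4)\<close>: this is the source of the second kind of coefficients in
  \<open>C\<close>.\<close>

lemma V_sq_W: "p \<in> E (m - 1) u \<Longrightarrow> p * (V m * V m) \<in> W (2 * int (wt m) - u)"
proof -
  assume p: "p \<in> E (m - 1) u"
  have "p * (V m * V m) = sg u * ((X (m + 1) * p) * V (m + 3))"
    using E_commute_X[OF p, of "m + 1"] by (simp add: V_sq) (metis mult.assoc)
  moreover have "(X (m + 3 - 2) * p) * V (m + 3) \<in> W (2 * int (wt m) - u)"
    using p by (intro W_gen C_X) (simp_all add: wt_add_3)
  ultimately show ?thesis by (simp add: W_sg)
qed

text \<open>Each use of \<open>V_V_gt\<close> raises n by 3 until n and m are equal or adjacent,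
  where \<open>V_sq\<close> or \<open>V_V_Suc\<close> ends the descent.\<close>

lemma V_V_W:
  "n \<le> m \<Longrightarrow> p \<in> E (m - 1) u \<Longrightarrow> p * (V n * V m + V m * V n) \<in> W (int (wt n) + int (wt m) - u)"
proof (induction "m - n" arbitrary: n p u rule: less_induct)
  case less
  \<comment> \<open>Stated for every k and for p in \<open>E k\<close>, since for m = n + 2 the
    recursion overshoots to the pair m, m + 1 and p has picked up x_{m-1}.\<close>
  have Suc: "p * (V k * V (Suc k) + V (Suc k) * V k) \<in> W (int (wt k) + int (wt (Suc k)) - u)"
    if "p \<in> E k u" for k p u
  proof -
    have "p * X k \<in> E (Suc k) (u + int (wt k))"
      by (intro E_mult E_X E_Suc that) simp
    then have "p * X k * V (k + 3) \<in> W (int (wt k) + int (wt (Suc k)) - u)"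
      by (intro W_gen C_E) (simp add: wt_add_3 algebra_simps)
    then show ?thesis using W_uminus by (simp add: V_V_Suc[simplified] mult.assoc)
  qed
  consider "n = m" | "m = Suc n" | "m = n + 2" | "n + 3 \<le> m" using less.prems by linarith
  then show ?case
  proof cases
    case 1
    then show ?thesis using W_add[OF V_sq_W V_sq_W] less.prems by (simp add: distrib_left)
  next
    case 2
    then show ?thesis using Suc[of p n u] less.prems by simp
  next
    case 3
    have "p * (X n * X (Suc n)) \<in> E (n + 2) (u + (int (wt n) + int (wt (Suc n))))"
      using 3 by (intro E_mult E_X E_mono[OF less.prems(2)]) auto
    from Suc[OF this] have "p * (X n * X (Suc n)) * (V (n + 3) * V m + V m * V (n + 3))
        \<in> W (int (wt m) + int (wt (n + 3)) - (u + (int (wt n) + int (wt (Suc n)))))"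
      using 3 by (simp add: add.commute numeral_3_eq_3)
    then show ?thesis using 3 V_V_gt[of n m] by (simp add: wt_add_3 algebra_simps)
  next
    case 4
    have "p * (X n * X (Suc n)) \<in> E (m - 1) (u + (int (wt n) + int (wt (Suc n))))"
      using 4 by (intro E_mult E_X less.prems) auto
    from less.hyps[OF _ _ this, of "n + 3"] 4
    have "p * (X n * X (Suc n)) * (V (n + 3) * V m + V m * V (n + 3))
        \<in> W (int (wt (n + 3)) + int (wt m) - (u + (int (wt n) + int (wt (Suc n)))))"
      by simp
    then show ?thesis using 4 V_V_gt[of n m] by (simp add: wt_add_3 algebra_simps)
  qed
qed

text \<open>For n <= m, v_m does not act on c, so the bracket is, up to sign, c d [v_n, v_m] plus c
  v_n(d) v_m. These two terms are covered by \<open>V_V_W\<close> and \<open>sder_C\<close>.\<close>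

lemma gen_bracket_W:
  assumes c: "c \<in> C n (int (wt n) - w)" and d: "d \<in> C m (int (wt m) - w')" and "n \<le> m"
  shows "c * V n * (d * V m) - sg (w * w') * (d * V m * (c * V n)) \<in> W (w + w')"
proof -
  let ?u = "int (wt n) - w" and ?v = "int (wt m) - w'"
  have cE: "c \<in> E (n - 1) ?u" and dE: "d \<in> E (m - 1) ?v"
    by (rule C_subset_E[OF c] C_subset_E[OF d])+
  have cE': "c \<in> E (m - 1) ?u" by (rule E_mono[OF cE]) (use \<open>n \<le> m\<close> in simp)
  have Vd: "V n * d = sg ?v * (d * V n) + sder n ?v d" by (simp add: sder_def)
  have Vc: "V m * c = sg ?u * (c * V m)" by (rule V_E[OF cE']) simp
  have dc: "d * c = sg (?u * ?v) * (c * d)" by (rule E_commute[OF cE dE])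
  have "c * V n * (d * V m) = c * (V n * d) * V m" by (simp add: mult.assoc)
  also have "\<dots> = sg ?v * (c * d * (V n * V m)) + c * sder n ?v d * V m"
    by (simp add: Vd algebra_simps sg_comm_assoc)
  finally have 1: "c * V n * (d * V m) = sg ?v * (c * d * (V n * V m)) + c * sder n ?v d * V m" .
  have "d * V m * (c * V n) = d * (V m * c) * V n" by (simp add: mult.assoc)
  also have "\<dots> = sg ?u * (d * c * (V m * V n))"
    by (simp add: Vc mult.assoc sg_comm_assoc)
  also have "\<dots> = sg (?u + ?u * ?v) * (c * d * (V m * V n))"
    by (simp add: dc mult.assoc sg_mult_assoc)
  finally have "sg (w * w') * (d * V m * (c * V n)) = sg (w * w' + (?u + ?u * ?v)) * (c * d * (V m * V n))"
    by (simp add: sg_mult_assoc)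
  also have "sg (w * w' + (?u + ?u * ?v)) = (- sg ?v :: 'a)"
    unfolding sg_uminus by (rule sg_parity) auto
  finally have 2: "sg (w * w') * (d * V m * (c * V n)) = - sg ?v * (c * d * (V m * V n))" .
  have "c * V n * (d * V m) - sg (w * w') * (d * V m * (c * V n)) =
      sg ?v * (c * d * (V n * V m + V m * V n)) + c * sder n ?v d * V m"
    unfolding 1 2 by (simp add: algebra_simps)
  moreover have "c * d * (V n * V m + V m * V n) \<in> W (int (wt n) + int (wt m) - (?u + ?v))"
    by (rule V_V_W[OF \<open>n \<le> m\<close> E_mult[OF cE' dE]])
  moreover have "c * sder n ?v d * V m \<in> W (w + w')"
  proof (cases "n = m")
    case True
    then show ?thesis using sder_eq_0[OF dE, of n] W_zero by simp
  next
    case False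
    with \<open>n \<le> m\<close> have "c * sder n ?v d \<in> C m (?v + ?u - int (wt n))"
      by (intro sder_C d cE) simp
    then show ?thesis by (intro W_gen) (simp add: algebra_simps)
  qed
  ultimately show ?thesis by (simp add: W_add W_sg)
qed

lemma bracket_W:
  assumes a: "a \<in> W w" and b: "b \<in> W w'"
  shows "a * b - sg (w * w') * (b * a) \<in> W (w + w')"
  using a
proof (induction rule: W.induct)
  case W_zero
  then show ?case by (simp add: W.W_zero)
next
  case (W_add a a')
  have "(a + a') * b - sg (w * w') * (b * (a + a')) =
    (a * b - sg (w * w') * (b * a)) + (a' * b - sg (w * w') * (b * a'))"
    by (simp add: algebra_simps)
  then show ?case using W.W_add[OF W_add.IH] by simp
next
  case (W_gen c n)
  note c = this
  from b show ?case
  proof (induction rule: W.induct)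
    case W_zero
    then show ?case by (simp add: W.W_zero)
  next
    case (W_add b b')
    have "c * V n * (b + b') - sg (w * w') * ((b + b') * (c * V n)) =
      (c * V n * b - sg (w * w') * (b * (c * V n))) + (c * V n * b' - sg (w * w') * (b' * (c * V n)))"
      by (simp add: algebra_simps)
    then show ?case using W.W_add[OF W_add.IH] by simp
  next
    case (W_gen d m)
    show ?case
    proof (cases "n \<le> m")
      case True
      then show ?thesis by (rule gen_bracket_W[OF c W_gen])
    next
      case False
      then have "d * V m * (c * V n) - sg (w' * w) * (c * V n * (d * V m)) \<in> W (w' + w)"
        by (intro gen_bracket_W c W_gen) simp
      from W_uminus[OF W_sg[OF this, of "w * w'"]] show ?thesis
        by (simp add: right_diff_distrib sg_mult_assoc add.commute mult.commute[of w' w])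
          (simp add: sg_def)
    qed
  qed
qed

text \<open>For odd a, b the square of a + b is a^2 + b^2 + [a, b], and (c v_n)^2 = c^2 v_n^2
  because c is even. No division by 2 occurs, so characteristic 2 is covered.\<close>

lemma square_W:
  assumes "a \<in> W w" "odd w" shows "a * a \<in> W (2 * w)"
  using assms(1)
proof (induction rule: W.induct)
  case W_zero
  then show ?case by (simp add: W.W_zero)
next
  case (W_add a b)
  have "a * b - sg (w * w) * (b * a) \<in> W (w + w)" by (intro bracket_W W_add)
  then have "a * b + b * a \<in> W (2 * w)" using \<open>odd w\<close> by (simp add: sg_def)
  moreover have "(a + b) * (a + b) = a * a + b * b + (a * b + b * a)"
    by (simp add: algebra_simps)
  ultimately show ?case using W.W_add W_add.IH by simp
next
  case (W_gen c n)
  let ?u = "int (wt n) - w"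
  have c: "c \<in> E (n - 1) ?u" using W_gen by (rule C_subset_E)
  have "V n * c = c * V n" using V_E[OF c, of n] \<open>odd w\<close> by (simp add: sg_def)
  then have "c * V n * (c * V n) = c * c * (V n * V n)" by (metis mult.assoc)
  moreover have "c * c * (V n * V n) \<in> W (2 * int (wt n) - (?u + ?u))"
    by (intro V_sq_W E_mult c)
  ultimately show ?case by simp
qed

end

section \<open>Lie monomials\<close>

context pivot_algebra
begin

inductive_set L :: "(nat \<times> 'a) set" where
  L_gen: "i < 3 \<Longrightarrow> (1, V i) \<in> L"
| L_br: "(m, a) \<in> L \<Longrightarrow> (n, b) \<in> L \<Longrightarrow> (m + n, a * b - sg (int m * int n) * (b * a)) \<in> L"

text \<open>Signs do not affect spans, so they are dropped here.\<close>

definition Lpm :: "nat \<Rightarrow> 'a \<Rightarrow> bool" where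
  "Lpm m a \<longleftrightarrow> (m, a) \<in> L \<or> (m, - a) \<in> L"

lemma Lpm_uminus: "Lpm m (- a) \<longleftrightarrow> Lpm m a"
  by (auto simp: Lpm_def)

lemma Lpm_sg: "Lpm m (sg u * a) \<longleftrightarrow> Lpm m a"
  by (simp add: sg_def Lpm_uminus)

lemma Lpm_br:
  assumes "Lpm m a" "Lpm n b"
  shows "Lpm (m + n) (a * b - sg (int m * int n) * (b * a))"
proof -
  have *: "(m, c) \<in> L \<Longrightarrow> (n, d) \<in> L \<Longrightarrow> Lpm (m + n) (c * d - sg (int m * int n) * (d * c))" for c d
    by (simp add: Lpm_def L_br)
  show ?thesis using assms(1) unfolding Lpm_def[of m]
  proof
    assume a: "(m, a) \<in> L"
    show ?thesis using assms(2) unfolding Lpm_def[of n]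
    proof
      assume "(n, - b) \<in> L"
      from *[OF a this] show ?thesis
        using Lpm_uminus[of "m + n" "a * b - sg (int m * int n) * (b * a)"] by simp
    qed (rule *[OF a])
  next
    assume a: "(m, - a) \<in> L"
    show ?thesis using assms(2) unfolding Lpm_def[of n]
    proof
      assume "(n, b) \<in> L"
      from *[OF a this] show ?thesis
        using Lpm_uminus[of "m + n" "a * b - sg (int m * int n) * (b * a)"] by simp
    next
      assume "(n, - b) \<in> L"
      from *[OF a this] show ?thesis by simp
    qed
  qed
qed

lemma V_V_factor: "j < n \<Longrightarrow> \<exists>z. V j * V n + V n * V j = X j * z"
proof -
  assume "j < n"
  then consider "n = Suc j" | "j + 2 \<le> n" by linarith
  then show ?thesis
  proof cases
    case 1
    then show ?thesis using V_V_Suc[of j] by (intro exI[of _ "- V (j + 3)"]) simp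
  next
    case 2
    then show ?thesis using V_V_gt[of j n] by (metis mult.assoc)
  qed
qed

text \<open>The bracket of v_j with x_j p v_n is p v_n: v_j x_j = 1 - x_j v_j and x_j v_j = x_j d_j
  give p v_n and a term with x_j p d_j v_n. The reversed product cancels that term, because x_j
  kills [v_j, v_n].\<close>

lemma Lpm_delete:
  assumes L: "Lpm m (X j * p * V n)" and "j < n" and "even (int m - u)"
    and pX: "p * X j = sg u * (X j * p)" and Dp: "D j * p = sg u * (p * D j)"
    and Vj: "Lpm (wt j) (V j)"
  shows "Lpm (wt j + m) (p * V n)"
proof -
  obtain z where z: "V j * V n + V n * V j = X j * z" using V_V_factor[OF \<open>j < n\<close>] by blast
  have XpX: "X j * p * X j = 0" unfolding mult.assoc pX by (simp add: sg_comm_assoc X_nil)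
  have Xp: "X j * p = sg u * (p * X j)" unfolding pX by (simp add: sg_def)
  have XpV: "X j * p * V j = X j * p * D j" unfolding Xp by (simp add: mult.assoc X_V)
  have "X j * p * (V j * V n + V n * V j) = 0"
    unfolding z using XpX by (metis mult.assoc mult_zero_left)
  then have "X j * p * V n * V j = - (X j * p * V j * V n)"
    by (simp add: distrib_left mult.assoc eq_neg_iff_add_eq_0 add.commute)
  then have 1: "X j * p * V n * V j = - (X j * p * D j * V n)" by (simp add: XpV)
  have "V j * (X j * p * V n) = p * V n - X j * V j * p * V n"
    using V_X_same[of j] by (simp add: algebra_simps) (metis mult.assoc add.commute distrib_right mult_1)
  also have "X j * V j * p * V n = sg u * (X j * p * D j * V n)"
    unfolding X_V by (simp add: mult.assoc Dp sg_comm_assoc)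
  finally have 2: "V j * (X j * p * V n) = p * V n - sg u * (X j * p * D j * V n)" .
  have "sg (int (wt j) * int m) = (sg u :: 'a)" by (rule sg_parity) (use assms(3) in auto)
  then have "V j * (X j * p * V n) - sg (int (wt j) * int m) * (X j * p * V n * V j) = p * V n"
    unfolding 1 2 by simp
  with Lpm_br[OF Vj L] show ?thesis by simp
qed

text \<open>[v_i, v_{i+1}] is -x_i v_{i+3}, and deleting x_i costs another v_i; the lengths add up
  to the recursion of \<open>wt\<close>.\<close>

lemma Lpm_V: "Lpm (wt i) (V i)"
proof (induction i rule: nat_induct3)
  case (4 i)
  have "Lpm (wt i + wt (Suc i)) (- (X i * V (i + 3)))"
    using Lpm_br[OF 4] V_V_Suc[of i] by (simp add: sg_def)
  then have "Lpm (wt i + wt (Suc i)) (X i * 1 * V (i + 3))"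
    by (simp add: Lpm_uminus)
  from Lpm_delete[where u = 0, OF this _ _ _ _ 4(1)] show ?case
    by (simp add: sg_def wt_add_3 mult_2 add.assoc)
qed (auto simp: Lpm_def intro: L_gen[of 0, simplified] L_gen[of 1, simplified] L_gen[of 2, simplified numeral_2_eq_2, simplified])

section \<open>Ordered monomials and the commutators containing them\<close>

primrec xs :: "nat \<Rightarrow> nat set \<Rightarrow> 'a" where
  "xs 0 R = 1"
| "xs (Suc k) R = (if k \<in> R then xs k R * X k else xs k R)"

lemma xs_E: "xs k R \<in> E k (int (\<Sum>i\<in>R \<inter> {..<k}. wt i))"
proof (induction k)
  case 0
  show ?case using E_one[of 0] by simp
next
  case (Suc k)
  show ?case
  proof (cases "k \<in> R")
    case True
    then have "R \<inter> {..<Suc k} = insert k (R \<inter> {..<k})" by auto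
    then have "(\<Sum>i\<in>R \<inter> {..<Suc k}. wt i) = (\<Sum>i\<in>R \<inter> {..<k}. wt i) + wt k" by simp
    moreover have "xs k R * X k \<in> E (Suc k) (int (\<Sum>i\<in>R \<inter> {..<k}. wt i) + int (wt k))"
      by (intro E_mult E_X E_Suc Suc) simp
    ultimately show ?thesis using True by (simp del: E.simps)
  next
    case False
    then have "R \<inter> {..<Suc k} = R \<inter> {..<k}" by (auto simp: less_Suc_eq)
    then show ?thesis using False E_Suc[OF Suc] by (simp del: E.simps)
  qed
qed

lemma xs_cong: "R \<inter> {..<k} = R' \<inter> {..<k} \<Longrightarrow> xs k R = xs k R'"
proof (induction k)
  case (Suc k)
  then have "R \<inter> {..<k} = R' \<inter> {..<k}" "k \<in> R \<longleftrightarrow> k \<in> R'" by (auto simp: set_eq_iff less_Suc_eq)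
  with Suc.IH show ?case by simp
qed simp

lemma xs_insert: "j < k \<Longrightarrow> j \<notin> R \<Longrightarrow> \<exists>u. xs k (insert j R) = sg u * (X j * xs k R)"
proof (induction k)
  case (Suc k)
  show ?case
  proof (cases "j = k")
    case True
    have "xs k (insert j R) = xs k R" by (rule xs_cong) (use True in auto)
    with True Suc.prems E_commute_X[OF xs_E[of k R], of k] show ?thesis by auto
  next
    case False
    with Suc obtain u where "xs k (insert j R) = sg u * (X j * xs k R)" by auto
    with False show ?thesis by (intro exI[of _ u]) (simp add: mult.assoc)
  qed
qed simp

lemma D_xs: "j \<notin> R \<Longrightarrow> D j * xs k R = sg (int (\<Sum>i\<in>R \<inter> {..<k}. wt i)) * (xs k R * D j)"
proof (induction k)
  case 0
  show ?case by (simp add: sg_def)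
next
  case (Suc k)
  show ?case
  proof (cases "k \<in> R")
    case True
    then have "R \<inter> {..<Suc k} = insert k (R \<inter> {..<k})" by auto
    then have s: "int (\<Sum>i\<in>R \<inter> {..<Suc k}. wt i) = int (\<Sum>i\<in>R \<inter> {..<k}. wt i) + int (wt k)" by simp
    have "D j * xs (Suc k) R = sg (int (\<Sum>i\<in>R \<inter> {..<k}. wt i)) * (xs k R * (D j * X k))"
      using True Suc by (simp flip: mult.assoc)
    also have "D j * X k = - (X k * D j)" by (rule D_X) (use True Suc.prems in auto)
    finally show ?thesis unfolding s using True by (simp add: sg_def mult.assoc)
  next
    case False
    then have "R \<inter> {..<Suc k} = R \<inter> {..<k}" by (auto simp: less_Suc_eq)
    then show ?thesis using False Suc by simp
  qed
qed

lemma Lpm_V_V2: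
  "Lpm (wt i + wt (i + 2)) (X i * (X (Suc i) * X (i + 2)) * V (i + 5))"
proof -
  have "V (i + 3) * V (i + 2) + V (i + 2) * V (i + 3) = - (X (i + 2) * V (i + 5))"
    using V_V_Suc[of "i + 2"] by (simp add: add.commute eval_nat_numeral)
  then have "V i * V (i + 2) + V (i + 2) * V i = - (X i * (X (Suc i) * X (i + 2)) * V (i + 5))"
    using V_V_gt[of i "i + 2"] by (simp add: mult.assoc)
  then show ?thesis
    using Lpm_br[OF Lpm_V[of i] Lpm_V[of "i + 2"]] by (simp add: sg_def Lpm_uminus)
qed

text \<open>Deletes x_i from [v_i, v_{i+2}]. With n = i + 3 this is the partner x_{n-2} x_{n-1}
  v_{n+2} used to lengthen full monomials.\<close>

lemma Lpm_pair: "Lpm (2 * wt i + wt (i + 2)) (X (Suc i) * X (i + 2) * V (i + 5))"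
proof -
  have p: "X (Suc i) * X (i + 2) \<in> E (i + 3) (int (wt (Suc i)) + int (wt (i + 2)))"
    by (intro E_mult E_X) auto
  have "D i * (X (Suc i) * X (i + 2)) = X (Suc i) * X (i + 2) * D i"
    using D_X[of i "Suc i"] D_X[of i "i + 2"] swap_assoc[OF D_X[of i "Suc i"]] by (simp add: mult.assoc)
  then have "Lpm (wt i + (wt i + wt (i + 2))) (X (Suc i) * X (i + 2) * V (i + 5))"
    using E_commute_X[OF p, of i] by (intro Lpm_delete[OF Lpm_V_V2, where u = 0] Lpm_V) (simp_all add: sg_def)
  then show ?thesis by (simp add: mult_2 add.assoc)
qed

text \<open>With f = x_0 ... x_{n-3} and s = x_{n-2} x_{n-1}, neither pivot acts on the other's
  coefficient, so [f v_n, s v_{n+2}] is f s [v_n, v_{n+2}]. The last bracket contributes x_n x_{n+1}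
  x_{n+2}, five new letters in all. The start is [v_0, v_2].\<close>

lemma Lpm_full:
  "\<exists>l. Lpm l (xs (5 * k + 3) UNIV * V (5 * k + 5)) \<and> l + (\<Sum>j<5 * k + 3. wt j) = wt (5 * k + 5)"
proof (induction k)
  case 0
  have "X 0 * (X (Suc 0) * X 2) = xs 3 UNIV" by (simp add: numeral_3_eq_3 mult.assoc numeral_2_eq_2)
  with Lpm_V_V2[of 0] have "Lpm 2 (xs 3 UNIV * V 5)" by (simp add: numeral_2_eq_2)
  then show ?case by (intro exI[of _ 2]) (simp add: eval_nat_numeral)
next
  case (Suc k)
  define i n where "i = 5 * k + 2" and "n = 5 * k + 5"
  define f where "f = xs (i + 1) UNIV"
  define s where "s = X (Suc i) * X (i + 2)"
  let ?T = "\<Sum>j<i + 1. wt j" and ?m = "2 * wt i + wt (i + 2)"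
  have n: "n = i + 3" by (simp add: i_def n_def)
  have "5 * k + 3 = i + 1" "5 * k + 5 = n" by (simp_all add: i_def n_def)
  from Suc[unfolded this] obtain l where l: "Lpm l (f * V n)" "l + ?T = wt n"
    unfolding f_def by blast
  have f: "f \<in> E (i + 1) (int ?T)" using xs_E[of "i + 1" UNIV] by (simp add: f_def)
  have s: "s \<in> E n (int (wt (Suc i)) + int (wt (i + 2)))"
    unfolding s_def n by (intro E_mult E_X) auto
  have Vs: "V n * s = s * V n" using V_E[OF s, of n] by (simp add: sg_def)
  have Vf: "V (n + 2) * f = sg (int ?T) * (f * V (n + 2))" by (rule V_E[OF f]) (simp add: n)
  have sf: "s * f = f * s" using E_commute[OF f s] by (simp add: sg_def)
  have "Lpm ?m (s * V (n + 2))" using Lpm_pair[of i] by (simp add: s_def n add.commute)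
  from Lpm_br[OF l(1) this]
  have br: "Lpm (l + ?m) (f * V n * (s * V (n + 2)) - sg (int l * int ?m) * (s * V (n + 2) * (f * V n)))" .
  have 1: "f * V n * (s * V (n + 2)) = f * s * (V n * V (n + 2))"
    using Vs by (metis mult.assoc)
  have "s * V (n + 2) * (f * V n) = s * (V (n + 2) * f) * V n" by (simp only: mult.assoc)
  also have "\<dots> = sg (int ?T) * (s * f * (V (n + 2) * V n))"
    unfolding Vf by (simp only: mult.assoc) (simp add: sg_def)
  finally have 2: "s * V (n + 2) * (f * V n) = sg (int ?T) * (f * s * (V (n + 2) * V n))"
    by (simp only: sf)
  \<comment> \<open>The length l and the weight of f add up to the odd number \<open>wt n\<close>,
    so the two signs combine to -1.\<close>
  have "odd (int l) \<longleftrightarrow> even (int ?T)"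
    using arg_cong[OF l(2), of even] by (simp del: of_nat_sum)
  then have 3: "sg (int l * int ?m) * (sg (int ?T) * c) = - c" for c :: 'a
    by (auto simp: sg_def simp del: of_nat_sum)
  have "f * V n * (s * V (n + 2)) - sg (int l * int ?m) * (s * V (n + 2) * (f * V n)) =
      f * s * (V n * V (n + 2) + V (n + 2) * V n)"
    unfolding 1 2 3 by (simp add: distrib_left)
  also have "V (n + 3) * V (n + 2) + V (n + 2) * V (n + 3) = - (X (n + 2) * V (n + 5))"
    using V_V_Suc[of "n + 2"] by (simp add: add.commute eval_nat_numeral)
  then have "V n * V (n + 2) + V (n + 2) * V n = - (X n * X (Suc n) * X (n + 2) * V (n + 5))"
    using V_V_gt[of n "n + 2"] by (simp add: mult.assoc)
  also have "f * s * - (X n * X (Suc n) * X (n + 2) * V (n + 5)) = - (xs (n + 3) UNIV * V (n + 5))"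
    by (simp add: f_def s_def n mult.assoc eval_nat_numeral)
  finally have "Lpm (l + ?m) (xs (n + 3) UNIV * V (n + 5))" using br by (simp add: Lpm_uminus)
  moreover have "l + ?m + (\<Sum>j<n + 3. wt j) = wt (n + 5)"
    using l(2) by (simp add: n eval_nat_numeral)
  ultimately show ?case by (intro exI[of _ "l + ?m"]) (simp add: n_def add.commute)
qed

text \<open>The letters outside R are deleted one by one from the full monomial. Deleting x_j raises
  the length by \<open>wt j\<close>, so length plus weight of the letters stays
  \<open>wt n\<close>.\<close>

lemma Lpm_monomial:
  assumes "R \<subseteq> {..<5 * k + 3}"
  shows "\<exists>l. Lpm l (xs (5 * k + 3) R * V (5 * k + 5)) \<and> l + (\<Sum>j\<in>R. wt j) = wt (5 * k + 5)"
proof -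
  let ?K = "5 * k + 3" and ?n = "5 * k + 5"
  have "\<exists>l. Lpm l (xs ?K ({..<?K} - A) * V ?n) \<and> l + (\<Sum>j\<in>{..<?K} - A. wt j) = wt ?n"
    if "finite A" "A \<subseteq> {..<?K}" for A
    using that
  proof (induction A rule: finite_induct)
    case empty
    have "xs ?K {..<?K} = xs ?K UNIV" by (rule xs_cong) auto
    then show ?case using Lpm_full[of k] by (simp del: xs.simps)
  next
    case (insert j A)
    let ?R = "{..<?K} - insert j A"
    have R: "{..<?K} - A = insert j ?R" "j \<notin> ?R" "j < ?K" "?R \<inter> {..<?K} = ?R" using insert by auto
    from insert.IH insert.prems obtain l where
      l: "Lpm l (xs ?K (insert j ?R) * V ?n)" "l + (\<Sum>j\<in>insert j ?R. wt j) = wt ?n"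
      unfolding R(1) by (meson insert_subset)
    from R(2) have l2: "l + (wt j + (\<Sum>j\<in>?R. wt j)) = wt ?n" using l(2) by (simp add: sum.insert[OF _ R(2)])
    obtain u where "xs ?K (insert j ?R) = sg u * (X j * xs ?K ?R)"
      using xs_insert[OF R(3,2)] by blast
    with l(1) have "Lpm l (X j * xs ?K ?R * V ?n)" by (simp add: mult.assoc Lpm_sg)
    moreover have "even (int l - int (\<Sum>i\<in>?R. wt i))"
      using arg_cong[OF l2, of even] by (simp del: of_nat_sum)
    moreover have "xs ?K ?R * X j = sg (int (\<Sum>i\<in>?R. wt i)) * (X j * xs ?K ?R)"
      using E_commute_X[OF xs_E[of ?K ?R], of j] R(4) by simp
    moreover have "D j * xs ?K ?R = sg (int (\<Sum>i\<in>?R. wt i)) * (xs ?K ?R * D j)"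
      using D_xs[OF R(2), of ?K] R(4) by simp
    ultimately have "Lpm (wt j + l) (xs ?K ?R * V ?n)"
      using R(3) by (intro Lpm_delete Lpm_V) auto
    with l2 show ?case by (intro exI[of _ "wt j + l"]) simp
  qed
  from this[of "{..<?K} - R"] assms show ?thesis by (simp add: double_diff)
qed

end

section \<open>Dimension bounds\<close>

context pivot_algebra
begin

lemma L_W: "(m, a) \<in> L \<Longrightarrow> a \<in> W (int m)"
proof (induction rule: L.induct)
  case (L_gen i)
  then have "wt i = 1" by (auto simp: less_Suc_eq numeral_3_eq_3)
  then show ?case using W_gen[of 1 i 1] C_E[OF E_one] by simp
next
  case (L_br m a n b)
  then show ?case using bracket_W by simp
qed

lemma E_weight_le: "p \<in> E k u \<Longrightarrow> p \<noteq> 0 \<Longrightarrow> u \<le> int (\<Sum>j<k. wt j)"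
proof (induction k arbitrary: p u)
  case 0
  then show ?case by (auto split: if_splits)
next
  case (Suc k)
  then obtain p0 p1 where p: "p = p0 + X k * p1" "p0 \<in> E k u" "p1 \<in> E k (u - int (wt k))" by auto
  then have "p0 \<noteq> 0 \<or> p1 \<noteq> 0" using Suc.prems by auto
  then show ?case using Suc.IH[OF p(2)] Suc.IH[OF p(3)] by force
qed

text \<open>A nonzero coefficient weighs at most that of the largest monomial of its kind, hence at
  most 10/11 of \<open>wt N\<close>; this leaves at least 1/11 for w.\<close>

lemma C_weight_bound:
  assumes c: "c \<in> C N (int (wt N) - w)" and "c \<noteq> 0"
  shows "int (wt N) \<le> 11 * w"
proof -
  have *: "int (wt N) \<le> 11 * w" if "p \<in> E (N - 2) (int (wt N) - w)" "p \<noteq> 0" for p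
  proof (cases "N < 2")
    case True
    then have "wt N = 1" by (auto simp: less_Suc_eq numeral_2_eq_2)
    with E_weight_le[OF that] True show ?thesis by simp
  next
    case False
    then have "11 * (\<Sum>j<N - 2. wt j) \<le> 10 * wt N"
      using sum_wt_bound[of "N - 2"] by (simp add: le_add_diff_inverse2 del: add_2_eq_Suc')
    then have "11 * int (\<Sum>j<N - 2. wt j) \<le> 10 * int (wt N)" by linarith
    with E_weight_le[OF that] show ?thesis by linarith
  qed
  from c show ?thesis
  proof (cases rule: C_cases)
    case (E p q)
    with * \<open>c \<noteq> 0\<close> show ?thesis by auto
  next
    case (X p q)
    show ?thesis
    proof (cases "p = 0")
      case True
      with X \<open>c \<noteq> 0\<close> have "q \<noteq> 0" by auto
      from E_weight_le[OF X(4) this]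
      have le: "int (wt N) - w - int (wt (N - 2)) \<le> int (\<Sum>j<N - 4. wt j)" .
      show ?thesis
      \<comment> \<open>For N = 3 subtraction truncates, and \<open>N - 4 + 4\<close> is no longer
        N.\<close>
      proof (cases "N = 3")
        case True
        with le show ?thesis by (simp add: numeral_3_eq_3)
      next
        case False
        with X(3) have "N - 2 = N - 4 + 2" "N = N - 4 + 4" by auto
        with sum_wt_bound'[of "N - 4"]
        have "11 * (wt (N - 2) + (\<Sum>j<N - 4. wt j)) \<le> 10 * wt N" by metis
        then have "int (11 * (wt (N - 2) + (\<Sum>j<N - 4. wt j))) \<le> int (10 * wt N)"
          by (simp only: of_nat_le_iff)
        then have "11 * (int (wt (N - 2)) + int (\<Sum>j<N - 4. wt j)) \<le> 10 * int (wt N)"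
          by (simp only: of_nat_mult of_nat_add of_nat_numeral)
        moreover have "c \<le> 11 * w" if "11 * (a + b) \<le> 10 * c" "c - w - a \<le> b" for a b c :: int
          using that by (simp add: distrib_left)
        ultimately show ?thesis using le by blast
      qed
    next
      case False
      with * X show ?thesis by blast
    qed
  qed
qed

section \<open>Counting the monomials that span the coefficients\<close>

primrec mons :: "nat \<Rightarrow> 'a set" where
  "mons 0 = {1}"
| "mons (Suc k) = mons k \<union> (*) (X k) ` mons k"

lemma finite_mons: "finite (mons k)"
  by (induction k) auto

lemma card_mons: "card (mons k) \<le> 2 ^ k"
proof (induction k)
  case (Suc k)
  have "card (mons (Suc k)) \<le> card (mons k) + card ((*) (X k) ` mons k)"
    by (simp add: card_Un_le)
  also have "card ((*) (X k) ` mons k) \<le> card (mons k)"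
    by (rule card_image_le[OF finite_mons])
  finally show ?case using Suc by simp
qed simp

end

section \<open>Transfer to operators on Lambda and the upper bound\<close>

global_interpretation Q: pivot_algebra Xop Dop Vop
  by unfold_locales
    (rule Xop_Xop Xop_sq Dop_sq Dop_Xop Dop_Xop_same Vop_Xop Vop_Dop Vop_rec; assumption?)+

interpretation op: vector_space oscale
  by unfold_locales (simp_all add: oscale_def fun_eq_iff algebra_simps)

lemma mat_add_fun: "mat (A + B) = mat A + mat B"
  by (simp add: fun_eq_iff mat_add)

lemma mat_minus_fun: "mat (A - B) = mat A - mat B"
  by (simp add: fun_eq_iff mat_minus)

lemma mat_uminus_fun: "mat (- A) = - mat A"
  by (simp add: fun_eq_iff mat_uminus)

lemma mat_zero_fun: "mat 0 = 0"
  by (simp add: fun_eq_iff mat_zero)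

lemma mat_of_int_mult_span:
  assumes "mat A \<in> op.span B" shows "mat (of_int x * A) \<in> op.span B"
proof (induction x rule: int_induct[where k = 0])
  case base
  show ?case using op.span_zero by (simp add: zero_fun_def mat_zero_fun)
next
  case (step1 x)
  then show ?case unfolding of_int_add of_int_1 distrib_right mult_1 mat_add_fun
    using assms by (intro op.span_add)
next
  case (step2 x)
  then show ?case
    unfolding of_int_diff of_int_1 left_diff_distrib mult_1 mat_minus_fun
    using assms by (intro op.span_diff)
qed

text \<open>The left factor a must be arbitrary: in the induction step it absorbs x_k.\<close>

lemma mat_E_span: "p \<in> Q.E k u \<Longrightarrow> mat (a * p * b) \<in> op.span ((\<lambda>q. mat (a * q * b)) ` Q.mons k)"
proof (induction k arbitrary: p u a)
  case 0
  then obtain x where p: "p = of_int x" by (auto split: if_splits intro: that[of 0])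
  have "a * p * b = of_int x * (a * 1 * b)" unfolding p by (simp flip: mult.assoc add: mult_of_int_commute)
  then show ?case using mat_of_int_mult_span[OF op.span_base, of "a * 1 * b"] by simp
next
  case (Suc k)
  then obtain p0 p1 where p: "p = p0 + Xop k * p1" "p0 \<in> Q.E k u" "p1 \<in> Q.E k (u - int (wt k))" by auto
  have "mat (a * p0 * b) \<in> op.span ((\<lambda>q. mat (a * q * b)) ` Q.mons (Suc k))"
    by (rule subsetD[OF op.span_mono Suc.IH[OF p(2)]]) auto
  moreover have "mat (a * Xop k * p1 * b) \<in> op.span ((\<lambda>q. mat (a * q * b)) ` Q.mons (Suc k))"
    by (rule subsetD[OF op.span_mono Suc.IH[OF p(3)]]) (simp add: image_Un image_image mult.assoc)
  ultimately show ?case unfolding p(1) distrib_left distrib_right mat_add_fun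
    by (simp only: mult.assoc) (rule op.span_add)
qed

text \<open>The bound \<open>N - 1\<close> covers both kinds of coefficients, by
  \<open>C_subset_E\<close>; summing powers of 2 over N < M still gives at most
  \<open>2 ^ M\<close>.\<close>

definition pivot_monomials :: "nat \<Rightarrow> 'k::field op set" where
  "pivot_monomials M = (\<Union>N<M. (\<lambda>q. mat (q * Vop N)) ` Q.mons (N - 1))"

lemma finite_pivot_monomials: "finite (pivot_monomials M)"
  by (simp add: pivot_monomials_def Q.finite_mons)

lemma card_pivot_monomials: "card (pivot_monomials M :: 'k::field op set) \<le> 2 ^ M"
proof -
  have "card (pivot_monomials M :: 'k op set) \<le>
      (\<Sum>N<M. card ((\<lambda>q. mat (q * Vop N :: 'k rop)) ` Q.mons (N - 1)))"
    unfolding pivot_monomials_def by (rule card_UN_le) simp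
  also have "\<dots> \<le> (\<Sum>N<M. 2 ^ N)"
  proof (rule sum_mono)
    fix N
    have "card ((\<lambda>q. mat (q * Vop N :: 'k rop)) ` Q.mons (N - 1)) \<le> card (Q.mons (N - 1) :: 'k rop set)"
      by (rule card_image_le[OF Q.finite_mons])
    also have "\<dots> \<le> 2 ^ (N - 1)" by (rule Q.card_mons)
    also have "\<dots> \<le> 2 ^ N" by (rule power_increasing) auto
    finally show "card ((\<lambda>q. mat (q * Vop N :: 'k rop)) ` Q.mons (N - 1)) \<le> 2 ^ N" .
  qed
  also have "\<dots> \<le> 2 ^ M" by (induction M) auto
  finally show ?thesis .
qed

lemma W_span:
  assumes "A \<in> Q.W w" and M: "\<And>N. int (wt N) \<le> 11 * w \<Longrightarrow> N < M"
  shows "mat A \<in> op.span (pivot_monomials M)"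
  using assms(1)
proof (induction rule: Q.W.induct)
  case W_zero
  show ?case using op.span_zero by (simp add: zero_fun_def mat_zero_fun)
next
  case (W_add a b)
  then show ?case unfolding mat_add_fun by (intro op.span_add)
next
  case (W_gen c N)
  show ?case
  proof (cases "c = 0")
    case True
    then show ?thesis using op.span_zero by (simp add: zero_fun_def mat_zero_fun)
  next
    case False
    then have "N < M" by (intro M Q.C_weight_bound[OF W_gen])
    then have "(\<lambda>q. mat (1 * q * Vop N)) ` Q.mons (N - 1) \<subseteq> (pivot_monomials M :: 'a op set)"
      by (auto simp: pivot_monomials_def)
    from subsetD[OF op.span_mono[OF this] mat_E_span[OF Q.C_subset_E[OF W_gen], of 1 "Vop N"]]
    show ?thesis by simp
  qed
qed

lemma mat_sg_times: "mat (sg u * A) S T = (if even u then mat A S T else - mat A S T)"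
  by (simp add: sg_def mat_uminus)

lemma sbracket_mat: "sbracket m n (mat A) (mat B) = mat (A * B - sg (int m * int n) * (B * A))"
  by (intro ext, simp only: sbracket_def mat_minus mat_sg_times) (simp add: times_rop.rep_eq)

lemma L_lie_mono: "(m, A) \<in> Q.L \<Longrightarrow> (m, mat A) \<in> lie_mono"
proof (induction rule: Q.L.induct)
  case (L_gen i)
  then show ?case using lie_mono.gen[of i, where 'k = 'a] by (simp add: Vop.rep_eq)
next
  case (L_br m a n b)
  then show ?case unfolding sbracket_mat[symmetric] by (intro lie_mono.br)
qed

lemma lie_mono_L: "(m, a) \<in> lie_mono \<Longrightarrow> \<exists>A. a = mat A \<and> (m, A) \<in> Q.L"
proof (induction rule: lie_mono.induct)
  case (gen i)
  then show ?case using Q.L_gen[of i, where 'a = 'a] by (intro exI[of _ "Vop i"]) (simp add: Vop.rep_eq)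
next
  case (br m a n b)
  then show ?case using Q.L_br sbracket_mat by metis
qed

lemma growth_set_subset_span:
  assumes M: "\<And>N. wt N \<le> 11 * n \<Longrightarrow> N < M"
  shows "growth_set TYPE('k::field) n \<subseteq> op.span (pivot_monomials M)"
proof
  fix a assume a: "a \<in> growth_set TYPE('k) n"
  have W: "mat A \<in> op.span (pivot_monomials M)" if "A \<in> Q.W (int m)" "m \<le> n" for A :: "'k rop" and m
    by (rule W_span[OF that(1)], rule M) (use that(2) in linarith)
  consider m where "m \<le> n" "(m, a) \<in> lie_mono"
    | m b where "a = ocomp b b" "(m, b) \<in> lie_mono" "odd m" "2 * m \<le> n"
    using a by (auto simp: growth_set_def split: if_splits)
  then show "a \<in> op.span (pivot_monomials M)"
  proof cases
    case 1
    with lie_mono_L obtain A where "a = mat A" "(m, A) \<in> Q.L" by blast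
    with W[OF Q.L_W] 1 show ?thesis by blast
  next
    case 2
    with lie_mono_L obtain B where B: "b = mat B" "(m, B) \<in> Q.L" by blast
    from Q.square_W[OF Q.L_W[OF B(2)]] 2 have "B * B \<in> Q.W (int (2 * m))" by simp
    from W[OF this] 2 B show ?thesis by (simp add: times_rop.rep_eq)
  qed
qed

lemma lie_growth_le:
  assumes "\<And>N. wt N \<le> 11 * n \<Longrightarrow> N < M"
  shows "lie_growth TYPE('k::field) n \<le> 2 ^ M"
proof -
  have "lie_growth TYPE('k) n \<le> card (pivot_monomials M :: 'k op set)"
    unfolding lie_growth_def
    by (rule op.dim_le_card[OF growth_set_subset_span finite_pivot_monomials]) (rule assms)
  also note card_pivot_monomials
  finally show ?thesis .
qed

text \<open>v_N(x_N) = 1, since the tail of v_N starts at v_{N+3}, which kills x_N. Applying r v_N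
  to x_N therefore returns r itself.\<close>

lemma mat_V_row: "mat (Vop N :: 'k::field rop) {N} = mat 1 {}"
proof
  fix T
  have "{j \<in> {N}. j < N} = {}" by auto
  then have "sgn_before N {N} = (1 :: 'k)" unfolding sgn_before_def by (simp only: card.empty power_0)
  moreover have "mat (Vop N :: 'k rop) {N} T = mat (Dop N) {N} T"
    by (subst Vop_rec) (simp add: mat_add mat_times_zero mat_Vop_zero)
  ultimately show "mat (Vop N :: 'k rop) {N} T = mat 1 {} T"
    by (auto simp: Dop.rep_eq one_rop.rep_eq pder_def oid_def)
qed

lemma mat_times_V_row: "mat (A * Vop N) {N} = mat A {}"
proof -
  have "ocomp (mat A) (mat (Vop N)) {N} = ocomp (mat A) (mat 1) {}"
    using mat_V_row[of N, where 'k = 'a] by (simp add: ocomp_def fun_eq_iff)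
  then show ?thesis by (metis mult_1_right times_rop.rep_eq)
qed

text \<open>General S is needed because \<open>xs\<close> multiplies by x_k on the right, so in the
  induction x_k moves into S.\<close>

lemma mat_xs:
  "finite S \<Longrightarrow> S \<inter> {..<k} = {} \<Longrightarrow>
    \<exists>s. s \<noteq> 0 \<and> (\<forall>T. mat (Q.xs k R :: 'k::field rop) S T = (if T = S \<union> (R \<inter> {..<k}) then s else 0))"
proof (induction k arbitrary: S)
  case 0
  then show ?case by (intro exI[of _ 1]) (auto simp: one_rop.rep_eq oid_def)
next
  case (Suc k)
  have k: "k \<notin> S" using Suc.prems by auto
  show ?case
  proof (cases "k \<in> R")
    case True
    have "insert k S \<inter> {..<k} = {}" using Suc.prems by auto
    from Suc.IH[OF _ this] Suc.prems obtain s where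
      s: "s \<noteq> 0" "\<forall>T. mat (Q.xs k R :: 'k rop) (insert k S) T = (if T = insert k S \<union> (R \<inter> {..<k}) then s else 0)"
      by auto
    have "insert k S \<union> (R \<inter> {..<k}) = S \<union> (R \<inter> {..<Suc k})" using True by auto
    with s True k Suc.prems show ?thesis
      by (intro exI[of _ "sgn_before k S * s"])
        (auto simp: times_rop.rep_eq Xop.rep_eq ocomp_lmul sgn_before_def)
  next
    case False
    have "S \<inter> {..<k} = {}" using Suc.prems by auto
    moreover have "R \<inter> {..<Suc k} = R \<inter> {..<k}" using False by (auto simp: less_Suc_eq)
    ultimately show ?thesis using Suc False by simp
  qed
qed

lemma sum_fun_apply2: "(\<Sum>i\<in>I. f i) S T = (\<Sum>i\<in>I. f i S T)"
  by (induction I rule: infinite_finite_induct) auto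

text \<open>Evaluated at x_N, the operators become nonzero multiples of distinct basis monomials
  x_R.\<close>

lemma xs_V_independent:
  fixes K N :: nat
  defines "Y \<equiv> \<lambda>R. mat (Q.xs K R * Vop N) :: 'k::field op"
  shows "inj_on Y (Pow {..<K})" "op.independent (Y ` Pow {..<K})"
proof -
  have "\<exists>s. \<forall>R. R \<subseteq> {..<K} \<longrightarrow> s R \<noteq> 0 \<and> (\<forall>T. Y R {N} T = (if T = R then s R else 0))"
  proof -
    have "\<exists>s. R \<subseteq> {..<K} \<longrightarrow> s \<noteq> 0 \<and> (\<forall>T. Y R {N} T = (if T = R then s else 0))" for R
      using mat_xs[of "{}" K R, where 'k = 'k] by (auto simp: Y_def mat_times_V_row Int_absorb2)
    then show ?thesis by metis
  qed
  then obtain s where s: "\<And>R. R \<subseteq> {..<K} \<Longrightarrow> s R \<noteq> 0"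
    "\<And>R T. R \<subseteq> {..<K} \<Longrightarrow> Y R {N} T = (if T = R then s R else 0)" by blast
  show inj: "inj_on Y (Pow {..<K})"
    by (rule inj_onI) (metis PowD s)
  show "op.independent (Y ` Pow {..<K})"
  proof (rule op.independent_if_scalars_zero)
    fix f x assume sum: "(\<Sum>x\<in>Y ` Pow {..<K}. oscale (f x) x) = 0" and x: "x \<in> Y ` Pow {..<K}"
    then obtain R where R: "R \<subseteq> {..<K}" "x = Y R" by auto
    have "0 = (\<Sum>R'\<in>Pow {..<K}. oscale (f (Y R')) (Y R')) {N} R"
      using sum by (simp add: sum.reindex[OF inj] comp_def)
    also have "\<dots> = (\<Sum>R'\<in>Pow {..<K}. f (Y R') * (if R = R' then s R' else 0))"
      unfolding sum_fun_apply2 by (rule sum.cong) (auto simp: oscale_def s)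
    also have "\<dots> = f (Y R) * s R" using R by (simp add: if_distrib cong: if_cong)
    finally show "f x = 0" using s(1) R by simp
  qed simp
qed

section \<open>Lower bound for the growth function\<close>

lemma Lpm_span:
  assumes "Q.Lpm l A" "l \<le> n"
  shows "mat (A :: 'k::field rop) \<in> op.span (growth_set TYPE('k) n)"
proof -
  have *: "mat B \<in> op.span (growth_set TYPE('k) n)" if "(l, B) \<in> Q.L" for B
    using L_lie_mono[OF that] assms(2) by (intro op.span_base) (auto simp: growth_set_def)
  show ?thesis using assms(1) *[of A] op.span_neg[OF *[of "- A"]]
    by (auto simp: Q.Lpm_def mat_uminus_fun)
qed

lemma less_3_wt: "N < 3 * wt N"
proof (induction N rule: nat_induct3)
  case (4 N)
  have "wt (Suc N) > 0" using odd_wt by (rule odd_pos)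
  moreover have "n + 3 < 3 * (2 * a + b)" if "n < 3 * a" "0 < b" for n a b :: nat
    using that by (simp add: distrib_left)
  ultimately show ?case unfolding wt_add_3 using 4 by blast
qed auto

text \<open>The finite set F guarantees that a basis of V is finite; for an infinite one,
  \<open>dim\<close> would be the default cardinality \<open>0\<close>.\<close>

lemma (in vector_space) card_le_dim_of_finite_span:
  assumes "independent S" "S \<subseteq> span V" "V \<subseteq> span F" "finite F"
  shows "card S \<le> dim V"
proof -
  obtain B where B: "B \<subseteq> V" "independent B" "V \<subseteq> span B" "card B = dim V"
    by (rule basis_exists)
  have "B \<subseteq> span F" using B(1) assms(3) by (rule subset_trans)
  then have "finite B" using independent_span_bound[OF assms(4) B(2)] by simp
  moreover have "S \<subseteq> span B"
    using assms(2) span_minimal[OF B(3) subspace_span] by (rule subset_trans)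
  ultimately show ?thesis using independent_span_bound[OF _ assms(1)] B(4) by metis
qed

lemma lie_growth_ge:
  assumes "wt (5 * k + 5) \<le> n"
  shows "2 ^ (5 * k + 3) \<le> lie_growth TYPE('k::field) n"
proof -
  define K N where "K = 5 * k + 3" and "N = 5 * k + 5"
  define Y where "Y = (\<lambda>R. mat (Q.xs K R * Vop N) :: 'k op)"
  have "Y R \<in> op.span (growth_set TYPE('k) n)" if R: "R \<subseteq> {..<K}" for R
  proof -
    obtain l where l: "Q.Lpm l (Q.xs K R * Vop N :: 'k rop)" "l + (\<Sum>j\<in>R. wt j) = wt N"
      using Q.Lpm_monomial[of R k, where 'a = 'k, folded K_def N_def, OF R] by blast
    then have "l \<le> n" using assms[folded N_def] by linarith
    with l(1) show ?thesis unfolding Y_def by (rule Lpm_span)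
  qed
  then have "Y ` Pow {..<K} \<subseteq> op.span (growth_set TYPE('k) n)" by blast
  \<comment> \<open>Supplies only finite dimensionality, so the crude bound N < 3
    \<open>wt N\<close> <= 33 n is enough.\<close>
  moreover have "growth_set TYPE('k) n \<subseteq> op.span (pivot_monomials (33 * n + 1))"
  proof (rule growth_set_subset_span)
    fix i assume "wt i \<le> 11 * n"
    with less_3_wt[of i] show "i < 33 * n + 1" by linarith
  qed
  moreover have "op.independent (Y ` Pow {..<K})"
    unfolding Y_def by (rule xs_V_independent)
  ultimately have "card (Y ` Pow {..<K}) \<le> lie_growth TYPE('k) n"
    unfolding lie_growth_def by (intro op.card_le_dim_of_finite_span[OF _ _ _ finite_pivot_monomials])
  moreover have "inj_on Y (Pow {..<K})"
    unfolding Y_def by (rule xs_V_independent)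
  ultimately show ?thesis by (simp add: card_image card_Pow K_def)
qed

section \<open>Asymptotics\<close>

lemma pivot_lambda: "pivot_lambda ^ 3 = pivot_lambda + 2" "1 < pivot_lambda"
proof -
  \<comment> \<open>The bound 13/10 makes 3/4 t^2 exceed 1, which gives uniqueness below.\<close>
  have "\<exists>t\<ge>13 / 10. t \<le> 2 \<and> t ^ 3 - t - 2 = (0::real)"
    by (rule IVT') (auto simp: power3_eq_cube intro!: continuous_intros)
  then obtain t :: real where t: "13 / 10 \<le> t" "t ^ 3 - t - 2 = 0" by blast
  have "s = t" if s: "s ^ 3 - s - 2 = 0" for s :: real
  proof (rule ccontr)
    assume "s \<noteq> t"
    moreover have "(s - t) * (s\<^sup>2 + s * t + t\<^sup>2 - 1) = (s ^ 3 - s - 2) - (t ^ 3 - t - 2)"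
      by (simp add: power2_eq_square power3_eq_cube algebra_simps)
    then have "(s - t) * (s\<^sup>2 + s * t + t\<^sup>2 - 1) = 0" unfolding s t(2) by simp
    ultimately have "s\<^sup>2 + s * t + t\<^sup>2 = 1" by simp
    moreover have "s\<^sup>2 + s * t + t\<^sup>2 = (s + t / 2)\<^sup>2 + 3 / 4 * t\<^sup>2"
      by (simp add: power2_eq_square field_simps)
    moreover have "(13 / 10)\<^sup>2 \<le> t\<^sup>2" using t(1) by (intro power_mono) auto
    then have "1 < 3 / 4 * t\<^sup>2" by (simp add: power2_eq_square)
    ultimately show False using zero_le_power2[of "s + t / 2"] by linarith
  qed
  then have "pivot_lambda = t"
    unfolding pivot_lambda_def using t(2) by (intro the_equality)
  then show "pivot_lambda ^ 3 = pivot_lambda + 2" "1 < pivot_lambda" using t by simp_all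
qed

lemma pivot_lambda_power: "pivot_lambda ^ (i + 3) = 2 * pivot_lambda ^ i + pivot_lambda ^ Suc i"
  by (simp add: power_add pivot_lambda(1) algebra_simps)

lemma wt_le: "real (wt i) \<le> pivot_lambda ^ i"
proof (induction i rule: nat_induct3)
  case (4 i)
  then show ?case unfolding wt_add_3 pivot_lambda_power by simp
qed (use pivot_lambda(2) less_1_mult[of pivot_lambda pivot_lambda] in simp_all)

text \<open>Powers of lambda obey the recursion of \<open>wt\<close>, so comparing i = 0, 1, 2
  suffices; the factor lambda^2 comes from i = 2.\<close>

lemma wt_ge: "pivot_lambda ^ i \<le> pivot_lambda\<^sup>2 * real (wt i)"
proof (induction i rule: nat_induct3)
  case (4 i)
  then show ?case unfolding wt_add_3 pivot_lambda_power by (simp add: algebra_simps)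
qed (use pivot_lambda(2) less_1_mult[of pivot_lambda pivot_lambda] in \<open>simp_all add: power2_eq_square\<close>)

lemma ln_lie_growth_upper:
  assumes "n \<ge> 1"
  shows "ln (real (lie_growth TYPE('k::field) n)) \<le> (ln (real n) / ln pivot_lambda + (log pivot_lambda (11 * pivot_lambda\<^sup>2) + 1)) * ln 2"
proof -
  let ?l = pivot_lambda
  let ?z = "log ?l (11 * ?l\<^sup>2 * real n)"
  define M where "M = nat \<lfloor>?z\<rfloor> + 1"
  have l: "1 < ?l" by (rule pivot_lambda)
  have pos: "11 * ?l\<^sup>2 * real n > 0" using l assms by simp
  have "1 \<le> ?l\<^sup>2" "1 \<le> real n" using l assms by (auto intro: one_le_power)
  then have "1 \<le> ?l\<^sup>2 * real n" using mult_mono[of 1 "?l\<^sup>2" 1 "real n"] by simp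
  then have "1 \<le> 11 * ?l\<^sup>2 * real n" by simp
  then have z: "0 \<le> ?z" using l pos by simp
  have "N < M" if "wt N \<le> 11 * n" for N
  proof -
    have "?l ^ N \<le> ?l\<^sup>2 * real (wt N)" by (rule wt_ge)
    also have "\<dots> \<le> ?l\<^sup>2 * real (11 * n)" using that by (intro mult_left_mono) auto
    finally have "?l ^ N \<le> 11 * ?l\<^sup>2 * real n" by simp
    then have "log ?l (?l ^ N) \<le> ?z" using l pos by (subst log_le_cancel_iff) auto
    then have "real N \<le> ?z" using l by simp
    then show ?thesis unfolding M_def by linarith
  qed
  from lie_growth_le[OF this] have le: "lie_growth TYPE('k) n \<le> 2 ^ M" .
  have "ln (real (lie_growth TYPE('k) n)) \<le> real M * ln 2"
  \<comment> \<open>In the zero case \<open>ln 0\<close> is \<open>0\<close>.\<close>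
  proof (cases "lie_growth TYPE('k) n = 0")
    case False
    with le have "ln (real (lie_growth TYPE('k) n)) \<le> ln (real (2 ^ M))"
      by (subst ln_le_cancel_iff) (auto simp: of_nat_le_iff[symmetric] simp del: of_nat_le_iff)
    then show ?thesis by (simp add: ln_realpow)
  qed simp
  also have "real M \<le> ?z + 1" unfolding M_def using z by linarith
  also have "?z = log ?l (11 * ?l\<^sup>2) + log ?l (real n)"
    using l assms by (subst log_mult) auto
  finally show ?thesis by (simp add: log_def algebra_simps)
qed

text \<open>5q is the largest multiple of 5 up to log_lambda n, and k = q - 1 is legitimate because
  n >= lambda^5. Rounding loses less than 5 and the exponent 5k + 3 = 5q - 2 another 2, hence the
  7.\<close>

lemma ln_lie_growth_lower:
  assumes "real n \<ge> pivot_lambda ^ 5"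
  shows "(ln (real n) / ln pivot_lambda - 7) * ln 2 \<le> ln (real (lie_growth TYPE('k::field) n))"
proof -
  let ?l = pivot_lambda
  define q where "q = nat \<lfloor>log ?l (real n) / 5\<rfloor>"
  have l: "1 < ?l" by (rule pivot_lambda)
  then have n: "0 < real n" using assms less_le_trans[of 0 "?l ^ 5" "real n"] by simp
  have "log ?l (?l ^ 5) \<le> log ?l (real n)" using l n assms by (subst log_le_cancel_iff) auto
  then have "5 \<le> log ?l (real n)" using l by simp
  then have "1 \<le> log ?l (real n) / 5" by simp
  then have q: "q \<ge> 1" "real q \<le> log ?l (real n) / 5" "log ?l (real n) / 5 < real q + 1"
    unfolding q_def by linarith+
  define k where "k = q - 1"
  have qk: "q = k + 1" using q by (simp add: k_def)
  have "real (5 * k + 5) \<le> log ?l (real n)" using q(2) qk by simp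
  then have "?l powr real (5 * k + 5) \<le> real n" using l n by (simp add: le_log_iff)
  then have "?l ^ (5 * k + 5) \<le> real n" using l by (simp only: powr_realpow)
  with wt_le[of "5 * k + 5"] have "wt (5 * k + 5) \<le> n" by linarith
  from lie_growth_ge[OF this] have "real (2 ^ (5 * k + 3)) \<le> real (lie_growth TYPE('k) n)"
    by (simp only: of_nat_le_iff)
  then have "ln (real (2 ^ (5 * k + 3))) \<le> ln (real (lie_growth TYPE('k) n))"
    by (rule ln_mono) simp
  then have "real (5 * k + 3) * ln 2 \<le> ln (real (lie_growth TYPE('k) n))"
    by (simp only: of_nat_power ln_realpow of_nat_numeral zero_less_numeral)
  moreover have "log ?l (real n) - 7 \<le> real (5 * k + 3)" using q(3) qk by simp
  then have "(log ?l (real n) - 7) * ln 2 \<le> real (5 * k + 3) * ln 2" by (rule mult_right_mono) simp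
  ultimately have "(log ?l (real n) - 7) * ln 2 \<le> ln (real (lie_growth TYPE('k) n))" by linarith
  then show ?thesis unfolding log_def .
qed

lemma tendsto_affine_ln_div_ln: "(\<lambda>n. (ln (real n) / a + b) * c / ln (real n)) \<longlonglongrightarrow> c / a"
proof -
  have ln: "filterlim (\<lambda>n. ln (real n)) at_top sequentially"
    by (rule filterlim_compose[OF ln_at_top filterlim_real_sequentially])
  have "(\<lambda>n. c / a + b * c / ln (real n)) \<longlonglongrightarrow> c / a + 0"
    by (intro tendsto_add tendsto_const tendsto_divide_0[OF tendsto_const]
        filterlim_at_top_imp_at_infinity ln)
  moreover have "\<forall>\<^sub>F n in sequentially. c / a + b * c / ln (real n) = (ln (real n) / a + b) * c / ln (real n)"
    using filterlim_at_top_dense[THEN iffD1, OF ln, rule_format, of 0]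
    by eventually_elim (simp add: field_simps)
  ultimately show ?thesis by (simp add: filterlim_cong[OF refl refl])
qed

text \<open>Both bounds on the logarithm have leading coefficient ln 2 / ln lambda; their constant
  terms vanish after division by ln n.\<close>

lemma lie_growth_exponent:
  "(\<lambda>n. ln (real (lie_growth TYPE('k::field) n)) / ln (real n)) \<longlonglongrightarrow> log pivot_lambda 2"
proof (rule tendsto_sandwich)
  let ?c = "log pivot_lambda (11 * pivot_lambda\<^sup>2) + 1"
  show "(\<lambda>n. (ln (real n) / ln pivot_lambda + - 7) * ln 2 / ln (real n)) \<longlonglongrightarrow> log pivot_lambda 2"
    unfolding log_def by (rule tendsto_affine_ln_div_ln)
  show "(\<lambda>n. (ln (real n) / ln pivot_lambda + ?c) * ln 2 / ln (real n)) \<longlonglongrightarrow> log pivot_lambda 2"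
    unfolding log_def[of pivot_lambda 2] by (rule tendsto_affine_ln_div_ln)
  have *: "\<forall>\<^sub>F n in sequentially. max 1 (pivot_lambda ^ 5) \<le> real n"
    using filterlim_at_top[THEN iffD1, OF filterlim_real_sequentially] by blast
  from * show "\<forall>\<^sub>F n in sequentially. (ln (real n) / ln pivot_lambda + - 7) * ln 2 / ln (real n)
      \<le> ln (real (lie_growth TYPE('k) n)) / ln (real n)"
    by eventually_elim (intro divide_right_mono, use ln_lie_growth_lower[where 'k = 'k] in auto)
  from * show "\<forall>\<^sub>F n in sequentially. ln (real (lie_growth TYPE('k) n)) / ln (real n)
      \<le> (ln (real n) / ln pivot_lambda + ?c) * ln 2 / ln (real n)"
    by eventually_elim (intro divide_right_mono, use ln_lie_growth_upper[where 'k = 'k] in auto)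
qed

theorem theorem8p4:
  shows "limsup (\<lambda>n. ereal (ln (real (lie_growth TYPE('k::field) n)) / ln (real n)))
           = ereal (log pivot_lambda 2)
       \<and> liminf (\<lambda>n. ereal (ln (real (lie_growth TYPE('k::field) n)) / ln (real n)))
           = ereal (log pivot_lambda 2)"
  using lim_imp_Limsup[OF _ tendsto_ereal[OF lie_growth_exponent]]
    lim_imp_Liminf[OF _ tendsto_ereal[OF lie_growth_exponent]]
  by auto

end
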